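(* Let $q$ be a prime power, $n\geq 0$ an integer, and set $t=q^n-1$. Then there is an orthogonal direct sum decomposition $$V(B_q(n+1)) = V(B_q(n)) \oplus W(0)\oplus W(1)\oplus\cdots\oplus W(t),$$ where: (i) $W(0),\ldots,W(t)$ are $U_{n+1}$-closed homogeneous subspaces of $V(B_q(n+1))$, with $\mathrm{rankset}(W(0))=\{1,\ldots,n+1\}$ and $\mathrm{rankset}(W(i))=\{1,\ldots,n\}$ for $i=1,\ldots,t$. (ii) $V(B_q(n))\oplus W(0)$ is $U_{n+1}$-closed, and there is an (explicit) linear map $\theta_n: V(B_q(n))\to W(0)$ which is an isomorphism of pairs $(V(B_q(n)), qU_n)$ and $(W(0),U_{n+1})$, sends homogeneous elements to homogeneous elements, increases rank by one, and satisfies $$U_{n+1}(v)=U_n(v)+\theta_n(v)\quad (v\in V(B_q(n))),$$ $$\langle \theta_n(w),\theta_n(v)\rangle = q^{n-k}\langle w,v\rangle\quad (w,v\in V(B_q(n)_k),\ 0\leq k\leq n).$$ (iii) For each $i=1,\ldots,t$ there is an (explicit) linear map $\gamma_{n-1}(i): V(B_q(n-1))\to W(i)$ which is an isomorphism of pairs $(V(B_q(n-1)),U_{n-1})$ and $(W(i),U_{n+1})$, sends homogeneous elements to homogeneous elements, increases rank by one, and satisfies $$\langle \gamma_{n-1}(i)(w),\gamma_{n-1}(i)(v)\rangle = q^{n+k}\langle w,v\rangle\quad (w,v\in V(B_q(n-1)_k),\ 0\leq k\leq n-1).$$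
   Context: $\mathbb{F}_q^m$ is the space of column vectors of length $m$ over the field $\mathbb{F}_q$; for $k<m$, $\mathbb{F}_q^k$ is identified with the subspace of $\mathbb{F}_q^m$ of vectors whose last $m-k$ coordinates are zero. $B_q(m)$ is the set of all subspaces of $\mathbb{F}_q^m$, partially ordered by inclusion and graded by dimension; $B_q(m)_k$ is the set of $k$-dimensional subspaces. For a finite set $S$, $V(S)$ is the complex vector space with basis $S$, equipped with the standard inner product $\langle x,y\rangle=\delta(x,y)$ for $x,y\in S$. For a graded poset $P$, $V(P)=\bigoplus_i V(P_i)$ where $P_i$ is the set of elements of rank $i$; a nonzero element of $V(P_i)$ is homogeneous of rank $i$; a subspace $W\subseteq V(P)$ is homogeneous if it contains the homogeneous components of each of its elements, and $\mathrm{rankset}(W)$ is the set of ranks of nonzero homogeneous elements of $W$. The up operator $U_m$ on $V(B_q(m))$ is the linear map with $U_m(x)=\sum_y y$, the sum over all $y\in B_q(m)$ covering $x$ (i.e. $x\subset y$, $\dim y=\dim x+1$). A subspace is $U$-closed if it is mapped into itself by $U$. An isomorphism of pairs $(V,f)$ and $(W,g)$ (finite-dimensional complex spaces with linear operators) is a linear isomorphism $\theta:V\to W$ with $\theta(f(v))=g(\theta(v))$ for all $v\in V$. *)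

theory Defs
  imports Complex_Main "HOL-Library.Function_Algebras" "HOL-Library.FuncSet" "HOL-Library.Cardinality"
begin

text \<open>
  Two kinds of vector spaces occur: spaces of coordinate vectors over the finite field, as
  functions \<open>nat \<Rightarrow> 'a\<close>, and free complex spaces on a finite set, as functions into
  \<open>complex\<close>. Both are instances of one pointwise vector space structure.
\<close>

definition fscale :: "'b::field \<Rightarrow> ('x \<Rightarrow> 'b) \<Rightarrow> 'x \<Rightarrow> 'b" where
  "fscale c f = (\<lambda>x. c * f x)"

interpretation fv: vector_space "fscale :: 'b::field \<Rightarrow> ('x \<Rightarrow> 'b) \<Rightarrow> 'x \<Rightarrow> 'b"
  by unfold_locales (auto simp: fscale_def fun_eq_iff algebra_simps)

definition linear_on :: "('x \<Rightarrow> 'b::field) set \<Rightarrow> (('x \<Rightarrow> 'b) \<Rightarrow> ('y \<Rightarrow> 'b)) \<Rightarrow> bool" where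
  "linear_on V f \<longleftrightarrow>
     (\<forall>v\<in>V. \<forall>w\<in>V. f (v + w) = f v + f w) \<and> (\<forall>c. \<forall>v\<in>V. f (fscale c v) = fscale c (f v))"

definition pair_iso :: "('x \<Rightarrow> complex) set \<Rightarrow> (('x \<Rightarrow> complex) \<Rightarrow> ('x \<Rightarrow> complex)) \<Rightarrow>
    ('y \<Rightarrow> complex) set \<Rightarrow> (('y \<Rightarrow> complex) \<Rightarrow> ('y \<Rightarrow> complex)) \<Rightarrow>
    (('x \<Rightarrow> complex) \<Rightarrow> ('y \<Rightarrow> complex)) \<Rightarrow> bool" where
  "pair_iso V f W g \<theta> \<longleftrightarrow>
     linear_on V \<theta> \<and> bij_betw \<theta> V W \<and> (\<forall>v\<in>V. \<theta> (f v) = g (\<theta> v))"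

text \<open>
  The space \<open>V(S)\<close> for a finite set \<open>S\<close> consists of the functions vanishing outside \<open>S\<close>, so that
  \<open>V(S)\<close> is literally a subspace of \<open>V(T)\<close> when \<open>S\<close> is a subset of \<open>T\<close>.
\<close>

definition free_space :: "'s set \<Rightarrow> ('s \<Rightarrow> complex) set" where
  "free_space S = {f. \<forall>x. x \<notin> S \<longrightarrow> f x = 0}"

definition basis_vec :: "'s \<Rightarrow> 's \<Rightarrow> complex" where
  "basis_vec x = (\<lambda>y. if y = x then 1 else 0)"

definition std_inner :: "'s set \<Rightarrow> ('s \<Rightarrow> complex) \<Rightarrow> ('s \<Rightarrow> complex) \<Rightarrow> complex" where
  "std_inner S f g = (\<Sum>x\<in>S. f x * cnj (g x))"

text \<open>
  Uniqueness of the components is stated for extensional families, since values of \<open>f\<close> outside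
  the index set are irrelevant. Sums of components lie in \<open>V\<close> because \<open>V\<close> is a subspace.
\<close>

definition orth_direct_sum ::
  "'s set \<Rightarrow> ('s \<Rightarrow> complex) set \<Rightarrow> 'i set \<Rightarrow> ('i \<Rightarrow> ('s \<Rightarrow> complex) set) \<Rightarrow> bool" where
  "orth_direct_sum S V I A \<longleftrightarrow>
     fv.subspace V \<and> (\<forall>i\<in>I. fv.subspace (A i) \<and> A i \<subseteq> V) \<and>
     (\<forall>v\<in>V. \<exists>!f. f \<in> Pi\<^sub>E I A \<and> v = (\<Sum>i\<in>I. f i)) \<and>
     (\<forall>i\<in>I. \<forall>j\<in>I. i \<noteq> j \<longrightarrow> (\<forall>v\<in>A i. \<forall>w\<in>A j. std_inner S v w = 0))"

text \<open>
  \<open>coord_space m\<close> is the space of vectors of length \<open>m\<close>, padded with zeros; this makes the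
  identification of shorter vectors with vectors whose last coordinates are zero literal, and
  hence \<open>Bq k\<close> a subset of \<open>Bq m\<close> for \<open>k \<le> m\<close>.
\<close>

definition coord_space :: "nat \<Rightarrow> (nat \<Rightarrow> 'a::{field,finite}) set" where
  "coord_space m = {v. \<forall>i\<ge>m. v i = 0}"

definition Bq :: "nat \<Rightarrow> (nat \<Rightarrow> 'a::{field,finite}) set set" where
  "Bq m = {X. fv.subspace X \<and> X \<subseteq> coord_space m}"

definition Bq_level :: "nat \<Rightarrow> nat \<Rightarrow> (nat \<Rightarrow> 'a::{field,finite}) set set" where
  "Bq_level m k = {X \<in> Bq m. fv.dim X = k}"

text \<open>The linear extension of the map sending \<open>X\<close> to the sum of all \<open>Y\<close> covering it.\<close>

definition up_op :: "nat \<Rightarrow> ((nat \<Rightarrow> 'a::{field,finite}) set \<Rightarrow> complex) \<Rightarrow>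
    (nat \<Rightarrow> 'a) set \<Rightarrow> complex" where
  "up_op m f =
     (\<Sum>X\<in>Bq m. fscale (f X) (\<Sum>Y\<in>{Y \<in> Bq m. X \<subset> Y \<and> fv.dim Y = fv.dim X + 1}. basis_vec Y))"

definition up_closed :: "nat \<Rightarrow> ((nat \<Rightarrow> 'a::{field,finite}) set \<Rightarrow> complex) set \<Rightarrow> bool" where
  "up_closed m W \<longleftrightarrow> (\<forall>w\<in>W. up_op m w \<in> W)"

definition homogeneous :: "nat \<Rightarrow> nat \<Rightarrow> ((nat \<Rightarrow> 'a::{field,finite}) set \<Rightarrow> complex) \<Rightarrow> bool" where
  "homogeneous m k v \<longleftrightarrow> v \<noteq> 0 \<and> v \<in> free_space (Bq_level m k)"

definition hom_component :: "nat \<Rightarrow> nat \<Rightarrow> ((nat \<Rightarrow> 'a::{field,finite}) set \<Rightarrow> complex) \<Rightarrow>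
    (nat \<Rightarrow> 'a) set \<Rightarrow> complex" where
  "hom_component m k v = (\<lambda>X. if X \<in> Bq_level m k then v X else 0)"

definition homogeneous_subspace ::
  "nat \<Rightarrow> ((nat \<Rightarrow> 'a::{field,finite}) set \<Rightarrow> complex) set \<Rightarrow> bool" where
  "homogeneous_subspace m W \<longleftrightarrow>
     fv.subspace W \<and> W \<subseteq> free_space (Bq m) \<and> (\<forall>w\<in>W. \<forall>k. hom_component m k w \<in> W)"

definition rankset :: "nat \<Rightarrow> ((nat \<Rightarrow> 'a::{field,finite}) set \<Rightarrow> complex) set \<Rightarrow> nat set" where
  "rankset m W = {k. \<exists>w\<in>W. homogeneous m k w}"

text \<open>The sums over \<open>Bq m\<close> above are genuine, since \<open>Bq m\<close> is finite.\<close>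

lemma finite_coord_space: "finite (coord_space m :: (nat \<Rightarrow> 'a::{field,finite}) set)"
proof -
  have "finite {f :: nat \<Rightarrow> 'a. \<forall>i. (i \<in> {..<m} \<longrightarrow> f i \<in> UNIV) \<and> (i \<notin> {..<m} \<longrightarrow> f i = 0)}"
    by (rule finite_set_of_finite_funs) auto
  moreover have "coord_space m \<subseteq>
      {f :: nat \<Rightarrow> 'a. \<forall>i. (i \<in> {..<m} \<longrightarrow> f i \<in> UNIV) \<and> (i \<notin> {..<m} \<longrightarrow> f i = 0)}"
    by (auto simp: coord_space_def)
  ultimately show ?thesis
    by (rule finite_subset[rotated])
qed

lemma finite_Bq: "finite (Bq m :: (nat \<Rightarrow> 'a::{field,finite}) set set)"
  by (rule finite_subset[of _ "Pow (coord_space m)"]) (auto simp: Bq_def finite_coord_space)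

lemma up_op_basis_vec:
  fixes X :: "(nat \<Rightarrow> 'a::{field,finite}) set"
  assumes "X \<in> Bq m"
  shows "up_op m (basis_vec X) =
    (\<Sum>Y\<in>{Y \<in> Bq m. X \<subset> Y \<and> fv.dim Y = fv.dim X + 1}. basis_vec Y)"
proof -
  have "up_op m (basis_vec X) = (\<Sum>Z\<in>Bq m. if Z = X then
      (\<Sum>Y\<in>{Y \<in> Bq m. X \<subset> Y \<and> fv.dim Y = fv.dim X + 1}. basis_vec Y) else 0)"
    unfolding up_op_def by (rule sum.cong) (auto simp: basis_vec_def)
  also have "\<dots> = (\<Sum>Y\<in>{Y \<in> Bq m. X \<subset> Y \<and> fv.dim Y = fv.dim X + 1}. basis_vec Y)"
    using assms by (simp add: finite_Bq)
  finally show ?thesis .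
qed

end

theory Submission
  imports Defs
begin

text \<open>
  Write \<open>E\<close> for \<open>coord_space n\<close> and fix a nontrivial additive character \<open>\<psi>\<close> of the field. A subspace
  \<open>Y\<close> of \<open>coord_space (n + 1)\<close> that is not contained in \<open>E\<close> is determined by \<open>X = Y \<inter> E\<close> and its slice
  \<open>{v \<in> Y. v n = 1}\<close>, a coset of \<open>X\<close>. For \<open>u \<in> E\<close> let \<open>G u Y\<close> be the sum of \<open>\<psi> (u \<bullet> v)\<close> over the
  slice; it vanishes unless \<open>X\<close> is orthogonal to \<open>u\<close>. The pieces of the decomposition are the
  \<open>q\<^sup>n\<close> spaces of functions \<open>Y \<mapsto> h (Y \<inter> E) * G u Y\<close>.

  If \<open>X\<close> is a hyperplane of \<open>Y \<inter> E\<close>, the slices of the hyperplanes \<open>Z\<close> of \<open>Y\<close> with \<open>Z \<inter> E = X\<close> partition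
  the slice of \<open>Y\<close>. Hence the up operator acts on these functions by acting on \<open>h\<close>. Character
  orthogonality makes the pieces orthogonal and, together with \<open>V(B\<^sub>q(n))\<close>, spanning. Since only
  subspaces of the orthogonal complement of \<open>u\<close> matter, a piece is a copy of \<open>V(B\<^sub>q(n-1))\<close>
  for \<open>u \<noteq> 0\<close> and of \<open>V(B\<^sub>q(n))\<close> for \<open>u = 0\<close>.
\<close>

section \<open>Additive characters of a finite field\<close>

text \<open>
  The quotient of the additive group by a maximal proper subgroup \<open>H\<close> is cyclic, generated by any
  \<open>x \<notin> H\<close>; if its order is \<open>r\<close>, the character sends \<open>x\<close> to a primitive \<open>r\<close>-th root of unity.
\<close>

lemma finite_field_nontrivial_character:
  obtains \<psi> :: "'a::{field,finite} \<Rightarrow> complex" and a :: 'a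
  where "\<And>x y. \<psi> (x + y) = \<psi> x * \<psi> y" "\<And>x. cnj (\<psi> x) = \<psi> (- x)" "\<psi> 0 = 1" "\<psi> a \<noteq> 1"
proof -
  define sub where "sub = (\<lambda>H::'a set. 0 \<in> H \<and> (\<forall>a\<in>H. \<forall>b\<in>H. a - b \<in> H))"
  have "{0} \<noteq> (UNIV :: 'a set)" by (metis UNIV_I singletonD zero_neq_one)
  then have "sub {0} \<and> {0} \<noteq> (UNIV :: 'a set)" by (simp add: sub_def)
  moreover have "\<forall>K. sub K \<and> K \<noteq> (UNIV::'a set) \<longrightarrow> card K < Suc (card (UNIV::'a set))"
    by (simp add: card_mono less_Suc_eq_le)
  \<comment> \<open>Maximality refers to cardinality: a subgroup with more elements than
    \<open>H\<close> must be the whole field.\<close>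
  ultimately have "\<exists>H. (sub H \<and> H \<noteq> UNIV) \<and> (\<forall>K. sub K \<and> K \<noteq> UNIV \<longrightarrow> card K \<le> card H)"
    by (rule Lattices_Big.ex_has_greatest_nat)
  then obtain H where H: "sub H" "H \<noteq> UNIV"
    and max: "\<And>K. sub K \<Longrightarrow> card H < card K \<Longrightarrow> K = UNIV"
    using not_le by blast
  have H0: "0 \<in> H" and Hd: "\<And>a b. a \<in> H \<Longrightarrow> b \<in> H \<Longrightarrow> a - b \<in> H"
    using H(1) by (auto simp: sub_def)
  have Hm: "- a \<in> H" if "a \<in> H" for a using Hd[OF H0 that] by simp
  have Ha: "a + b \<in> H" if "a \<in> H" "b \<in> H" for a b using Hd[OF that(1) Hm[OF that(2)]] by simp
  obtain x where x: "x \<notin> H" using H(2) by auto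
  \<comment> \<open>\<open>r\<close> is the order of \<open>x\<close> modulo \<open>H\<close>; it
    exists because the characteristic annihilates \<open>x\<close>.\<close>
  define r where "r = (LEAST k. k > 0 \<and> of_nat k * x \<in> H)"
  have ex: "\<exists>k. k > 0 \<and> of_nat k * x \<in> H"
    by (rule exI[of _ "CHAR('a)"]) (simp add: finite_imp_CHAR_pos H0)
  have r: "r > 0" "of_nat r * x \<in> H"
    using LeastI_ex[OF ex] by (auto simp: r_def)
  have rmin: "k = 0" if "k < r" "of_nat k * x \<in> H" for k
    using not_less_Least[of k "\<lambda>k. k > 0 \<and> of_nat k * x \<in> H"] that by (auto simp: r_def)
  have mult: "of_int j * y \<in> H" if "y \<in> H" for j y
  proof -
    have "of_nat k * y \<in> H" for k
      by (induction k) (auto simp: H0 algebra_simps intro!: Ha that)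
    then show ?thesis
      by (cases j rule: int_cases2) (auto intro: Hm)
  qed
  have r2: "r \<noteq> 1" using r(2) x by auto
  \<comment> \<open>The remainder of \<open>j\<close> modulo \<open>r\<close> also multiplies
    \<open>x\<close> into \<open>H\<close>, so it is 0 by minimality of \<open>r\<close>.\<close>
  have dvd: "int r dvd j" if "of_int j * x \<in> H" for j
  proof -
    have "of_int (j mod int r) * x = of_int j * x - of_int (j div int r) * (of_nat r * x)"
      by (simp add: minus_div_mult_eq_mod[symmetric] algebra_simps)
    then have "of_int (j mod int r) * x \<in> H" using Hd mult r(2) that by simp
    then have "of_nat (nat (j mod int r)) * x \<in> H" using r(1) by simp
    moreover have "nat (j mod int r) < r" using r(1)
      by (metis nat_int nat_less_iff of_nat_0_less_iff pos_mod_bound pos_mod_sign)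
    ultimately have "nat (j mod int r) = 0" using rmin by blast
    moreover have "0 \<le> j mod int r" using r(1) by simp
    ultimately have "j mod int r = 0" by linarith
    then show ?thesis by auto
  qed
  \<comment> \<open>\<open>K\<close> is the subgroup generated by \<open>H\<close> and
    \<open>x\<close>; being larger than \<open>H\<close>, it is everything.\<close>
  define K where "K = {y. \<exists>j::int. y - of_int j * x \<in> H}"
  have "sub K"
    unfolding sub_def K_def
  proof (safe)
    show "\<exists>j. 0 - of_int j * x \<in> H" by (rule exI[of _ 0]) (simp add: H0)
  next
    fix a b i j assume "a - of_int i * x \<in> H" "b - of_int j * x \<in> H"
    then have "(a - of_int i * x) - (b - of_int j * x) \<in> H" by (rule Hd)
    then show "\<exists>k. a - b - of_int k * x \<in> H"
      by (intro exI[of _ "i - j"]) (simp add: algebra_simps)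
  qed
  have "H \<subset> K"
  proof
    show "H \<subseteq> K" by (auto simp: K_def intro!: exI[of _ 0])
    have "x \<in> K" by (auto simp: K_def H0 intro!: exI[of _ 1])
    with x show "H \<noteq> K" by auto
  qed
  then have "card H < card K" by (simp add: psubset_card_mono)
  then have KU: "K = UNIV" by (rule max[OF \<open>sub K\<close>])
  define J where "J y = (SOME j::int. y - of_int j * x \<in> H)" for y
  have J: "y - of_int (J y) * x \<in> H" for y
    unfolding J_def by (rule someI_ex) (use KU in \<open>auto simp: K_def\<close>)
  define \<psi> where "\<psi> y = cis (2 * pi * of_int (J y) / of_nat r)" for y
  have \<psi>: "\<psi> y = cis (2 * pi * of_int j / of_nat r)" if "y - of_int j * x \<in> H" for y j
  proof -
    have "(y - of_int j * x) - (y - of_int (J y) * x) \<in> H" using that J by (rule Hd)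
    then have "of_int (J y - j) * x \<in> H" by (simp add: algebra_simps)
    then obtain k where "J y - j = int r * k" using dvd by (meson dvdE)
    then have "J y = j + int r * k" by simp
    then have "2 * pi * of_int (J y) / of_nat r = 2 * pi * of_int j / of_nat r + 2 * pi * of_int k"
      using r(1) by (simp add: field_simps)
    then have "\<psi> y = cis (2 * pi * of_int j / of_nat r) * cis (2 * pi * of_int k)"
      unfolding \<psi>_def by (simp only: cis_mult)
    then show ?thesis by simp
  qed
  show thesis
  proof
    show "\<psi> (y + z) = \<psi> y * \<psi> z" for y z
    proof -
      have "(y - of_int (J y) * x) + (z - of_int (J z) * x) \<in> H" by (intro Ha J)
      then have "(y + z) - of_int (J y + J z) * x \<in> H" by (simp add: algebra_simps)
      from \<psi>[OF this] show ?thesis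
        by (simp add: \<psi>_def cis_mult algebra_simps add_divide_distrib)
    qed
    show "cnj (\<psi> y) = \<psi> (- y)" for y
    proof -
      have "- (y - of_int (J y) * x) \<in> H" by (intro Hm J)
      then have "- y - of_int (- J y) * x \<in> H" by (simp add: algebra_simps)
      from \<psi>[OF this] show ?thesis
        by (simp add: \<psi>_def cis_cnj)
    qed
    show "\<psi> 0 = 1" using \<psi>[of 0 0] H0 by simp
    \<comment> \<open>Exponent 1 represents \<open>x\<close>, so \<open>\<psi> x\<close> is
      \<open>cis (2 * pi / r)\<close>; this is 1 only for \<open>r = 1\<close>, which would put
      \<open>x\<close> into \<open>H\<close>.\<close>
    show "\<psi> x \<noteq> 1"
    proof
      assume "\<psi> x = 1"
      moreover have "\<psi> x = cis (2 * pi / of_nat r)" using \<psi>[of x 1] H0 by simp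
      ultimately have "cos (2 * pi / real r) = 1" by (simp add: complex_eq_iff)
      then obtain k :: int where "2 * pi / real r = of_int k * 2 * pi"
        by (auto simp: cos_one_2pi_int)
      then have "1 = of_int k * real r" using r(1) by (simp add: field_simps)
      then have "1 = k * int r" by (metis of_int_1 of_int_eq_iff of_int_mult of_int_of_nat_eq)
      then have "int r dvd 1" by (metis dvd_triv_right)
      then show False using r2 by simp
    qed
  qed
qed

section \<open>Cardinalities and dimensions of subspaces\<close>

lemma subspace_coord_space: "fv.subspace (coord_space m)"
  by (auto simp: fv.subspace_def coord_space_def fscale_def)

lemma BqD:
  assumes "X \<in> Bq m"
  shows "fv.subspace X" "X \<subseteq> coord_space m" "finite X"
  using assms finite_subset[OF _ finite_coord_space] by (auto simp: Bq_def)

lemma card_Bq_pos: "X \<in> Bq m \<Longrightarrow> card X > 0"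
  using BqD[of X m] fv.subspace_0[of X] by (auto simp: card_gt_0_iff)

text \<open>Every vector of \<open>Y\<close> is \<open>x + fscale c w\<close> for a unique pair of
  \<open>x\<close> in \<open>X\<close> and a scalar \<open>c\<close>. The hypothesis
  \<open>dec\<close> stands in for a dimension condition, as dimensions are themselves counted with
  this lemma.\<close>

lemma card_hyperplane:
  fixes X Y :: "(nat \<Rightarrow> 'a::{field,finite}) set"
  assumes X: "fv.subspace X" and Y: "fv.subspace Y" and "X \<subseteq> Y" and w: "w \<in> Y" "w \<notin> X"
    and dec: "\<And>y. y \<in> Y \<Longrightarrow> \<exists>c. y - fscale c w \<in> X"
  shows "card Y = CARD('a) * card X"
proof -
  have "bij_betw (\<lambda>(c, x). x + fscale c w) (UNIV \<times> X) Y"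
    unfolding bij_betw_def
  proof
    show "inj_on (\<lambda>(c, x). x + fscale c w) (UNIV \<times> X)"
    proof (rule inj_onI, clarify)
      fix c x d y assume *: "x \<in> X" "y \<in> X" "x + fscale c w = y + fscale d w"
      \<comment> \<open>If \<open>c \<noteq> d\<close>, dividing by \<open>c - d\<close> would put
        \<open>w\<close> into \<open>X\<close>.\<close>
      have "fscale (c - d) w = y - x"
        using *(3) by (auto simp: fun_eq_iff fscale_def algebra_simps)
      then have "fscale (c - d) w \<in> X" using fv.subspace_diff[OF X] * by simp
      then have "fscale (inverse (c - d)) (fscale (c - d) w) \<in> X" by (rule fv.subspace_scale[OF X])
      then have "c = d" using w(2) by (cases "c = d") auto
      then show "c = d \<and> x = y" using * by simp
    qed
    show "(\<lambda>(c, x). x + fscale c w) ` (UNIV \<times> X) = Y"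
    proof safe
      fix c x assume "x \<in> X"
      then show "x + fscale c w \<in> Y"
        using \<open>X \<subseteq> Y\<close> w(1) by (auto intro!: fv.subspace_add[OF Y] fv.subspace_scale[OF Y])
    next
      fix y assume "y \<in> Y"
      then obtain c where "y - fscale c w \<in> X" using dec by blast
      then show "y \<in> (\<lambda>(c, x). x + fscale c w) ` (UNIV \<times> X)"
        by (intro image_eqI[of _ _ "(c, y - fscale c w)"]) auto
    qed
  qed
  from bij_betw_same_card[OF this] show ?thesis by (simp add: card_cartesian_product)
qed

text \<open>Induction over a basis, each vector multiplying the cardinality of the span by the field
  size. Dimension conditions can thus be replaced by cardinality conditions, which bijections
  preserve.\<close>

lemma card_eq_power_dim:
  fixes X :: "(nat \<Rightarrow> 'a::{field,finite}) set"
  assumes "fv.subspace X" "finite X"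
  shows "card X = CARD('a) ^ fv.dim X"
proof -
  obtain B where B: "B \<subseteq> X" "fv.independent B" "X \<subseteq> fv.span B" "card B = fv.dim X"
    using fv.basis_exists by blast
  have X: "X = fv.span B" using B assms(1) fv.span_minimal by (metis subset_antisym)
  have "finite B" using B assms(2) finite_subset by blast
  then have "card (fv.span B) = CARD('a) ^ card B" using B(2)
  proof (induction B)
    case empty
    then show ?case by simp
  next
    case (insert b B)
    have "card (fv.span (insert b B)) = CARD('a) * card (fv.span B)"
    proof (rule card_hyperplane[where w = b])
      show "fv.span B \<subseteq> fv.span (insert b B)" by (rule fv.span_mono) auto
      show "b \<in> fv.span (insert b B)" by (simp add: fv.span_base)
      show "b \<notin> fv.span B" using insert by (auto simp: fv.independent_insert split: if_splits)
      show "\<exists>c. y - fscale c b \<in> fv.span B" if "y \<in> fv.span (insert b B)" for y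
        using that by (auto simp: fv.span_insert)
    qed auto
    moreover have "fv.independent B" using insert.prems fv.independent_mono by blast
    ultimately show ?case using insert by simp
  qed
  then show ?thesis using X B(4) by simp
qed

lemma card_field_gt_1: "CARD('a::{field,finite}) > 1"
proof -
  have "card {0, 1 :: 'a} \<le> CARD('a)" by (rule card_mono) auto
  then show ?thesis by simp
qed

lemma card_Bq: "X \<in> Bq m \<Longrightarrow> card X = CARD('a) ^ fv.dim X"
  for X :: "(nat \<Rightarrow> 'a::{field,finite}) set"
  using BqD card_eq_power_dim by blast

lemma dim_eq_iff_card:
  fixes X :: "(nat \<Rightarrow> 'a::{field,finite}) set"
  assumes "X \<in> Bq m"
  shows "fv.dim X = k \<longleftrightarrow> card X = CARD('a) ^ k"
  using card_Bq[OF assms] card_field_gt_1[where 'a='a] by simp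

text \<open>\<open>X\<close> and \<open>Y\<close> may come from different ambient spaces, as
  \<open>Y\<close> and \<open>Y \<inter> coord_space n\<close> do.\<close>

lemma dim_Suc_iff_card:
  fixes X Y :: "(nat \<Rightarrow> 'a::{field,finite}) set"
  assumes "X \<in> Bq m" "Y \<in> Bq k"
  shows "fv.dim Y = fv.dim X + 1 \<longleftrightarrow> card Y = CARD('a) * card X"
proof -
  have "card Y = CARD('a) * card X \<longleftrightarrow> CARD('a) ^ fv.dim Y = CARD('a) ^ (fv.dim X + 1)"
    using card_Bq[OF assms(1)] card_Bq[OF assms(2)] by simp
  also have "\<dots> \<longleftrightarrow> fv.dim Y = fv.dim X + 1"
    using card_field_gt_1[where 'a='a] by (subst power_inject_exp) auto
  finally show ?thesis by simp
qed

lemma coord_space_Suc_iff: "v \<in> coord_space n \<longleftrightarrow> v \<in> coord_space (Suc n) \<and> v n = 0"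
  unfolding coord_space_def by (auto simp: Suc_le_eq) (metis le_neq_implies_less)

lemma coord_space_mono: "m \<le> n \<Longrightarrow> coord_space m \<subseteq> coord_space n"
  by (auto simp: coord_space_def)

lemma coord_space_in_Bq: "m \<le> n \<Longrightarrow> coord_space m \<in> Bq n"
  using coord_space_mono subspace_coord_space by (auto simp: Bq_def)

lemma Bq_mono: "m \<le> n \<Longrightarrow> Bq m \<subseteq> Bq n"
  using coord_space_mono unfolding Bq_def by blast

lemma Bq_Int_coord_space: "Y \<in> Bq (Suc n) \<Longrightarrow> Y \<inter> coord_space n \<in> Bq n"
  by (auto simp: Bq_def intro!: fv.subspace_inter subspace_coord_space)

lemma Bq_Suc_not_subset:
  assumes "Y \<in> Bq (Suc n)" "\<not> Y \<subseteq> coord_space n"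
  obtains v where "v \<in> Y" "v n = 1"
proof -
  obtain w where w: "w \<in> Y" "w \<notin> coord_space n" using assms(2) by auto
  then have "w n \<noteq> 0" using BqD(2)[OF assms(1)] coord_space_Suc_iff by blast
  then show thesis
    using that[of "fscale (inverse (w n)) w"] fv.subspace_scale[OF BqD(1)[OF assms(1)] w(1)]
    by (simp add: fscale_def)
qed

lemma card_Int_coord_space:
  fixes Y :: "(nat \<Rightarrow> 'a::{field,finite}) set"
  assumes Y: "Y \<in> Bq (Suc n)" and w: "w \<in> Y" "w n = 1"
  shows "card Y = CARD('a) * card (Y \<inter> coord_space n)"
proof (rule card_hyperplane[where w = w])
  show "fv.subspace (Y \<inter> coord_space n)" using Bq_Int_coord_space[OF Y] BqD by blast
  show "w \<notin> Y \<inter> coord_space n" using w coord_space_Suc_iff[of w n] by auto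
  show "\<exists>c. y - fscale c w \<in> Y \<inter> coord_space n" if y: "y \<in> Y" for y
  \<comment> \<open>As \<open>w n = 1\<close>, subtracting \<open>y n\<close> times \<open>w\<close>
    cancels the last coordinate.\<close>
  proof (intro exI[of _ "y n"])
    have *: "y - fscale (y n) w \<in> Y"
      using y w BqD(1)[OF Y] by (intro fv.subspace_diff fv.subspace_scale) auto
    moreover have "y - fscale (y n) w \<in> coord_space (Suc n)" using * BqD(2)[OF Y] by auto
    ultimately show "y - fscale (y n) w \<in> Y \<inter> coord_space n"
      using w(2) coord_space_Suc_iff[of "y - fscale (y n) w" n] by (auto simp: fscale_def)
  qed
qed (use assms BqD in auto)

lemma dim_Int_coord_space:
  fixes Y :: "(nat \<Rightarrow> 'a::{field,finite}) set"
  assumes Y: "Y \<in> Bq (Suc n)" and w: "w \<in> Y" "w n = 1"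
  shows "fv.dim Y = fv.dim (Y \<inter> coord_space n) + 1"
  using card_Int_coord_space[OF assms] dim_Suc_iff_card[OF Bq_Int_coord_space[OF Y] Y] by simp

lemma card_coord_space: "card (coord_space n :: (nat \<Rightarrow> 'a::{field,finite}) set) = CARD('a) ^ n"
proof (induction n)
  case 0
  have "coord_space 0 = {0 :: nat \<Rightarrow> 'a}" by (auto simp: coord_space_def fun_eq_iff)
  then show ?case by simp
next
  case (Suc n)
  let ?w = "(\<lambda>i. if i = n then 1 else 0) :: nat \<Rightarrow> 'a"
  have "?w \<in> coord_space (Suc n)" by (auto simp: coord_space_def)
  from card_Int_coord_space[OF coord_space_in_Bq[OF order_refl] this]
  have "card (coord_space (Suc n) :: (nat \<Rightarrow> 'a) set) = CARD('a) * card (coord_space (Suc n) \<inter> coord_space n :: (nat \<Rightarrow> 'a) set)"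
    by simp
  moreover have "coord_space (Suc n) \<inter> coord_space n = (coord_space n :: (nat \<Rightarrow> 'a) set)"
    using coord_space_mono[of n "Suc n"] by auto
  ultimately show ?case using Suc by simp
qed

lemma dim_coord_space: "fv.dim (coord_space n :: (nat \<Rightarrow> 'a::{field,finite}) set) = n"
  using dim_eq_iff_card[OF coord_space_in_Bq[OF order_refl]] card_coord_space by blast

lemma dim_Bq_le: "X \<in> Bq m \<Longrightarrow> fv.dim X \<le> m"
  for X :: "(nat \<Rightarrow> 'a::{field,finite}) set"
proof -
  assume X: "X \<in> Bq m"
  have "card X \<le> card (coord_space m :: (nat \<Rightarrow> 'a) set)"
    using BqD[OF X] finite_coord_space card_mono by blast
  then show ?thesis
    using card_Bq[OF X] card_field_gt_1[where 'a='a] by (simp add: card_coord_space)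
qed

section \<open>The up operator in coordinates\<close>

text \<open>The cover relation is read downwards from \<open>Y\<close> and expressed by
  cardinalities, the form that slices and charts deliver.\<close>

definition covered_by :: "nat \<Rightarrow> (nat \<Rightarrow> 'a::{field,finite}) set \<Rightarrow> (nat \<Rightarrow> 'a) set set" where
  "covered_by m Y = {X \<in> Bq m. X \<subset> Y \<and> card Y = CARD('a) * card X}"

lemma sum_fun_apply: "(\<Sum>i\<in>I. f i) x = (\<Sum>i\<in>I. f i x)"
  for f :: "'i \<Rightarrow> 'x \<Rightarrow> complex"
  by (induction I rule: infinite_finite_induct) auto

lemma finite_covered_by: "finite (covered_by m Y)"
  by (simp add: covered_by_def finite_Bq)

text \<open>The basis vector of \<open>Y\<close> occurs in the image of \<open>X\<close> exactly
  when \<open>Y\<close> covers \<open>X\<close>, so exchanging the sums gives the coefficient at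
  \<open>Y\<close>.\<close>

lemma up_op_apply:
  "up_op m f Y = (if Y \<in> Bq m then \<Sum>X\<in>covered_by m Y. f X else 0)"
  for Y :: "(nat \<Rightarrow> 'a::{field,finite}) set"
proof -
  have "up_op m f Y = (\<Sum>X\<in>Bq m. f X * (\<Sum>Z\<in>{Z \<in> Bq m. X \<subset> Z \<and> fv.dim Z = fv.dim X + 1}. basis_vec Z Y))"
    unfolding up_op_def sum_fun_apply fscale_def by simp
  also have "\<dots> = (\<Sum>X\<in>Bq m. if Y \<in> Bq m \<and> X \<subset> Y \<and> card Y = CARD('a) * card X then f X else 0)"
  proof (rule sum.cong[OF refl])
    fix X :: "(nat \<Rightarrow> 'a) set" assume X: "X \<in> Bq m"
    have "(\<Sum>Z\<in>{Z \<in> Bq m. X \<subset> Z \<and> fv.dim Z = fv.dim X + 1}. basis_vec Z Y) =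
      (if Y \<in> Bq m \<and> X \<subset> Y \<and> fv.dim Y = fv.dim X + 1 then 1 else 0)"
      by (auto simp: basis_vec_def finite_Bq)
    then show "f X * (\<Sum>Z\<in>{Z \<in> Bq m. X \<subset> Z \<and> fv.dim Z = fv.dim X + 1}. basis_vec Z Y) =
      (if Y \<in> Bq m \<and> X \<subset> Y \<and> card Y = CARD('a) * card X then f X else 0)"
      using dim_Suc_iff_card[OF X] by auto
  qed
  also have "\<dots> = (if Y \<in> Bq m then \<Sum>X\<in>covered_by m Y. f X else 0)"
    unfolding covered_by_def by (auto simp: sum.inter_filter finite_Bq)
  finally show ?thesis .
qed

section \<open>Orthogonal complements and slices\<close>

text \<open>Only the first \<open>n\<close> coordinates enter, so \<open>u\<close> can be paired
  with vectors of \<open>coord_space (Suc n)\<close> without projecting them.\<close>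

definition dotp :: "nat \<Rightarrow> (nat \<Rightarrow> 'a::{field,finite}) \<Rightarrow> (nat \<Rightarrow> 'a) \<Rightarrow> 'a" where
  "dotp n u v = (\<Sum>i<n. u i * v i)"

definition perp :: "nat \<Rightarrow> (nat \<Rightarrow> 'a::{field,finite}) \<Rightarrow> (nat \<Rightarrow> 'a) set" where
  "perp n u = {v \<in> coord_space n. dotp n u v = 0}"

text \<open>Coordinates are numbered from 0, so \<open>v n\<close> is the last coordinate in
  \<open>coord_space (Suc n)\<close>.\<close>

definition slice :: "nat \<Rightarrow> (nat \<Rightarrow> 'a::{field,finite}) set \<Rightarrow> (nat \<Rightarrow> 'a) set" where
  "slice n Y = {v \<in> Y. v n = 1}"

lemma dotp_simps:
  "dotp n u (v + w) = dotp n u v + dotp n u w"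
  "dotp n u (v - w) = dotp n u v - dotp n u w"
  "dotp n (u - u') v = dotp n u v - dotp n u' v"
  "dotp n u (fscale c v) = c * dotp n u v"
  by (simp_all add: dotp_def fscale_def algebra_simps sum.distrib sum_subtractf sum_distrib_left)

lemma dotp_commute: "dotp n u v = dotp n v u"
  by (simp add: dotp_def mult.commute)

lemma dotp_zero_left: "dotp n 0 v = 0"
  by (simp add: dotp_def)

lemma dotp_unit: "i < n \<Longrightarrow> dotp n u (fscale c (\<lambda>j. if j = i then 1 else 0)) = u i * c"
  by (simp add: dotp_def fscale_def if_distrib cong: if_cong)

lemma subspace_perp: "fv.subspace (perp n u)"
  using subspace_coord_space[of n]
  by (auto simp: fv.subspace_def perp_def dotp_simps) (simp add: dotp_def)

lemma perp_zero: "perp n 0 = coord_space n"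
  by (simp add: perp_def dotp_zero_left)

lemma coord_space_nonzero_coord:
  assumes "u \<in> coord_space n" "u \<noteq> 0"
  obtains i where "i < n" "u i \<noteq> 0"
proof -
  obtain i where i: "u i \<noteq> 0" using assms(2) by (auto simp: fun_eq_iff)
  then have "i < n" using assms(1) by (auto simp: coord_space_def not_le[symmetric])
  with i that show thesis by blast
qed

lemma slice_diff:
  assumes "Y \<in> Bq (Suc n)" "v \<in> slice n Y" "w \<in> slice n Y"
  shows "v - w \<in> Y \<inter> coord_space n"
proof -
  have "v - w \<in> Y" using assms by (auto simp: slice_def intro!: fv.subspace_diff BqD)
  moreover have "v - w \<in> coord_space (Suc n)" using calculation BqD(2)[OF assms(1)] by blast
  ultimately show ?thesis using assms coord_space_Suc_iff[of "v - w" n] by (auto simp: slice_def)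
qed

lemma slice_add:
  assumes "Y \<in> Bq (Suc n)" "v \<in> slice n Y" "x \<in> Y \<inter> coord_space n"
  shows "v + x \<in> slice n Y"
  using assms by (auto simp: slice_def coord_space_def intro!: fv.subspace_add BqD)

lemma slice_eq_translate:
  assumes "Y \<in> Bq (Suc n)" "v \<in> slice n Y"
  shows "slice n Y = (\<lambda>x. v + x) ` (Y \<inter> coord_space n)"
proof safe
  fix w assume "w \<in> slice n Y"
  then show "w \<in> (\<lambda>x. v + x) ` (Y \<inter> coord_space n)"
    using slice_diff[OF assms(1) _ assms(2)] by (intro image_eqI[of _ _ "w - v"]) auto
qed (use slice_add[OF assms] in auto)

lemma sum_slice:
  assumes "Y \<in> Bq (Suc n)" "v \<in> slice n Y"
  shows "(\<Sum>w\<in>slice n Y. f w) = (\<Sum>x\<in>Y \<inter> coord_space n. f (v + x))"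
  unfolding slice_eq_translate[OF assms] by (subst sum.reindex) (auto simp: inj_on_def)

lemma card_slice:
  assumes "Y \<in> Bq (Suc n)" "v \<in> slice n Y"
  shows "card (slice n Y) = card (Y \<inter> coord_space n)"
  unfolding slice_eq_translate[OF assms] by (rule card_image) (auto simp: inj_on_def)

lemma slice_empty_iff:
  assumes "Y \<in> Bq (Suc n)"
  shows "slice n Y = {} \<longleftrightarrow> Y \<subseteq> coord_space n"
proof
  assume "slice n Y = {}"
  then show "Y \<subseteq> coord_space n" using Bq_Suc_not_subset[OF assms] by (force simp: slice_def)
qed (force simp: slice_def coord_space_def)

lemma slice_subset:
  "Y \<in> Bq (Suc n) \<Longrightarrow> slice n Y \<subseteq> slice n (coord_space (Suc n))"
  using BqD(2) by (auto simp: slice_def)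

lemma finite_slice: "Y \<in> Bq (Suc n) \<Longrightarrow> finite (slice n Y)"
  using BqD(3)[of Y "Suc n"] by (auto simp: slice_def)

section \<open>Subspaces rebuilt from an intersection and a slice vector\<close>

definition extend :: "(nat \<Rightarrow> 'a::{field,finite}) set \<Rightarrow> (nat \<Rightarrow> 'a) \<Rightarrow> (nat \<Rightarrow> 'a) set" where
  "extend X v = fv.span (insert v X)"

lemma mem_extend_iff:
  assumes "fv.subspace X"
  shows "y \<in> extend X v \<longleftrightarrow> (\<exists>c. y - fscale c v \<in> X)"
proof -
  have "fv.span X = X" using assms by simp
  then show ?thesis by (simp add: extend_def fv.span_insert del: fv.span_eq_iff)
qed

text \<open>A vector of the span is a vector of \<open>X\<close> plus a multiple of
  \<open>v\<close>; since \<open>v n = 1\<close>, membership in \<open>coord_space n\<close> forces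
  the multiple to be 0.\<close>

lemma extend_props:
  assumes X: "X \<in> Bq n" and v: "v \<in> slice n (coord_space (Suc n))"
  shows "extend X v \<in> Bq (Suc n)" "v \<in> slice n (extend X v)" "extend X v \<inter> coord_space n = X"
proof -
  have v': "v \<in> coord_space (Suc n)" "v n = 1" using v by (auto simp: slice_def)
  have "X \<subseteq> coord_space (Suc n)" using BqD(2)[OF X] coord_space_mono[of n "Suc n"] by force
  then have "extend X v \<subseteq> coord_space (Suc n)"
    unfolding extend_def using v' by (intro fv.span_minimal subspace_coord_space) auto
  then show "extend X v \<in> Bq (Suc n)" by (auto simp: Bq_def extend_def)
  show "v \<in> slice n (extend X v)" using v' by (auto simp: slice_def extend_def fv.span_base)
  show "extend X v \<inter> coord_space n = X"
  proof safe
    fix y assume y: "y \<in> extend X v" "y \<in> coord_space n"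
    then obtain c where c: "y - fscale c v \<in> X" using mem_extend_iff BqD(1)[OF X] by blast
    then have "(y - fscale c v) n = 0" using BqD(2)[OF X] by (auto simp: coord_space_def)
    moreover have "y n = 0" using y by (auto simp: coord_space_def)
    ultimately have "c = 0" using v' by (simp add: fscale_def)
    then show "y \<in> X" using c by simp
  qed (use BqD(2)[OF X] in \<open>auto simp: extend_def fv.span_base\<close>)
qed

text \<open>Subtracting from a vector of \<open>Y\<close> its last coordinate times \<open>v\<close>
  leaves a vector of the intersection, so one slice vector and the intersection span
  \<open>Y\<close>.\<close>

lemma extend_unique:
  assumes Y: "Y \<in> Bq (Suc n)" and v: "v \<in> slice n Y"
  shows "extend (Y \<inter> coord_space n) v = Y"
proof -
  have X: "Y \<inter> coord_space n \<in> Bq n" by (rule Bq_Int_coord_space[OF Y])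
  have Ys: "fv.subspace Y" using BqD(1)[OF Y] .
  have vY: "v \<in> Y" "v n = 1" using v by (auto simp: slice_def)
  show ?thesis
  proof safe
    fix y assume "y \<in> extend (Y \<inter> coord_space n) v"
    then show "y \<in> Y" unfolding extend_def
      using fv.span_minimal[of "insert v (Y \<inter> coord_space n)" Y] vY Ys by auto
  next
    fix y assume y: "y \<in> Y"
    have "y - fscale (y n) v \<in> Y" using y vY Ys by (intro fv.subspace_diff fv.subspace_scale) auto
    moreover have "y - fscale (y n) v \<in> coord_space n"
      using calculation BqD(2)[OF Y] coord_space_Suc_iff[of "y - fscale (y n) v" n] vY
      by (auto simp: fscale_def)
    ultimately show "y \<in> extend (Y \<inter> coord_space n) v"
      using mem_extend_iff BqD(1)[OF X] by blast
  qed
qed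

text \<open>
  A subspace of \<open>coord_space (n + 1)\<close> not contained in \<open>coord_space n\<close>, together with a vector of
  its slice, is the same as a subspace of \<open>coord_space n\<close> together with a vector of the full slice.
\<close>

lemma sum_slices:
  "(\<Sum>Y\<in>Bq (Suc n). \<Sum>v\<in>slice n Y. f (Y \<inter> coord_space n) v) =
   (\<Sum>X\<in>Bq n. \<Sum>v\<in>slice n (coord_space (Suc n)). f X v)"
  for f :: "(nat \<Rightarrow> 'a::{field,finite}) set \<Rightarrow> (nat \<Rightarrow> 'a) \<Rightarrow> complex"
proof -
  have "(\<Sum>Y\<in>Bq (Suc n). \<Sum>v\<in>slice n Y. f (Y \<inter> coord_space n) v) =
    (\<Sum>(Y, v)\<in>(SIGMA Y:Bq (Suc n). slice n Y). f (Y \<inter> coord_space n) v)"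
    by (rule sum.Sigma) (auto simp: finite_Bq finite_slice)
  also have "\<dots> = (\<Sum>(X, v)\<in>Bq n \<times> slice n (coord_space (Suc n)). f X v)"
  proof (rule sum.reindex_bij_witness[where j = "\<lambda>(Y, v). (Y \<inter> coord_space n, v)" and i = "\<lambda>(X, v). (extend X v, v)"], goal_cases)
    case (2 a)
    then show ?case using slice_subset by (auto simp: Bq_Int_coord_space)
  next
    case (3 b)
    then show ?case using extend_props(3) by (cases b) (auto simp del: Int_iff)
  next
    case (4 b)
    then show ?case using extend_props(1,2) by auto
  qed (auto simp: extend_unique)
  also have "\<dots> = (\<Sum>X\<in>Bq n. \<Sum>v\<in>slice n (coord_space (Suc n)). f X v)"
    by (rule sum.cartesian_product[symmetric])
  finally show ?thesis .
qed

text \<open>The correspondence between \<open>(Z, v)\<close> and \<open>(X, v)\<close> respects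
  covers, because \<open>Y\<close> and \<open>Z\<close> both lose a factor of the field size when
  intersected with \<open>coord_space n\<close>. Subspaces \<open>Z\<close> inside
  \<open>coord_space n\<close> have empty slices and contribute nothing.\<close>

lemma sum_slices_covered:
  fixes f :: "(nat \<Rightarrow> 'a::{field,finite}) set \<Rightarrow> (nat \<Rightarrow> 'a) \<Rightarrow> complex"
  assumes Y: "Y \<in> Bq (Suc n)"
  shows "(\<Sum>Z\<in>covered_by (Suc n) Y. \<Sum>v\<in>slice n Z. f (Z \<inter> coord_space n) v) =
   (\<Sum>X\<in>covered_by n (Y \<inter> coord_space n). \<Sum>v\<in>slice n Y. f X v)"
proof -
  have cov: "Z \<inter> coord_space n \<in> covered_by n (Y \<inter> coord_space n)"
    if Z: "Z \<in> covered_by (Suc n) Y" and v: "v \<in> slice n Z" for Z v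
  proof -
    have Z': "Z \<in> Bq (Suc n)" "Z \<subseteq> Y" "card Y = CARD('a) * card Z"
      using Z by (auto simp: covered_by_def)
    have v': "v \<in> Z" "v \<in> Y" "v n = 1" using v Z' by (auto simp: slice_def)
    have c: "card (Y \<inter> coord_space n) = CARD('a) * card (Z \<inter> coord_space n)"
      using card_Int_coord_space[OF Y v'(2,3)] card_Int_coord_space[OF Z'(1) v'(1,3)] Z'(3) by simp
    moreover have "card (Z \<inter> coord_space n) > 0"
      using card_Bq_pos[OF Bq_Int_coord_space[OF Z'(1)]] .
    ultimately have "Z \<inter> coord_space n \<noteq> Y \<inter> coord_space n"
      using card_field_gt_1[where 'a='a] by auto
    then show ?thesis using c Z' Bq_Int_coord_space[OF Z'(1)] by (auto simp: covered_by_def)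
  qed
  have ext: "extend X v \<in> covered_by (Suc n) Y" and extv: "v \<in> slice n (extend X v)"
    and exti: "extend X v \<inter> coord_space n = X"
    if X: "X \<in> covered_by n (Y \<inter> coord_space n)" and v: "v \<in> slice n Y" for X v
  proof -
    have X': "X \<in> Bq n" "X \<subset> Y \<inter> coord_space n" "card (Y \<inter> coord_space n) = CARD('a) * card X"
      using X by (auto simp: covered_by_def)
    have vf: "v \<in> slice n (coord_space (Suc n))" using slice_subset[OF Y] v by blast
    note p = extend_props[OF X'(1) vf]
    show "v \<in> slice n (extend X v)" "extend X v \<inter> coord_space n = X" using p by auto
    have v': "v \<in> Y" "v n = 1" "v \<in> extend X v" using v p(2) by (auto simp: slice_def)
    have "extend X v \<subseteq> Y" unfolding extend_def
      using v' X' BqD(1)[OF Y] by (intro fv.span_minimal) auto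
    moreover have "extend X v \<noteq> Y" using p(3) X'(2) by auto
    moreover have "card Y = CARD('a) * card (extend X v)"
      using card_Int_coord_space[OF Y v'(1,2)] card_Int_coord_space[OF p(1) v'(3,2)] X'(3) p(3) by simp
    ultimately show "extend X v \<in> covered_by (Suc n) Y" using p(1) by (auto simp: covered_by_def)
  qed
  have "(\<Sum>Z\<in>covered_by (Suc n) Y. \<Sum>v\<in>slice n Z. f (Z \<inter> coord_space n) v) =
    (\<Sum>(Z, v)\<in>(SIGMA Z:covered_by (Suc n) Y. slice n Z). f (Z \<inter> coord_space n) v)"
    by (rule sum.Sigma) (auto simp: finite_covered_by, auto simp: covered_by_def finite_slice)
  also have "\<dots> = (\<Sum>(X, v)\<in>covered_by n (Y \<inter> coord_space n) \<times> slice n Y. f X v)"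
  proof (rule sum.reindex_bij_witness[where j = "\<lambda>(Z, v). (Z \<inter> coord_space n, v)" and i = "\<lambda>(X, v). (extend X v, v)"], goal_cases)
    case (1 a)
    then show ?case by (auto simp: extend_unique covered_by_def)
  next
    case (2 a)
    then show ?case using cov by (fastforce simp: covered_by_def[of "Suc n"] slice_def)
  next
    case (3 b)
    then show ?case using exti by auto
  next
    case (4 b)
    then show ?case using ext extv by auto
  next
    case (5 a)
    then show ?case by auto
  qed
  also have "\<dots> = (\<Sum>X\<in>covered_by n (Y \<inter> coord_space n). \<Sum>v\<in>slice n Y. f X v)"
    by (rule sum.cartesian_product[symmetric])
  finally show ?thesis .
qed

section \<open>Character sums and lifted functions\<close>

text \<open>Given \<open>psi_add\<close> and \<open>psi_zero\<close>, the conjugation law expresses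
  that all values have modulus 1; \<open>a\<close> witnesses nontriviality.\<close>

locale additive_character =
  fixes \<psi> :: "'a::{field,finite} \<Rightarrow> complex" and a :: 'a
  assumes psi_add: "\<psi> (x + y) = \<psi> x * \<psi> y"
    and cnj_psi: "cnj (\<psi> x) = \<psi> (- x)"
    and psi_zero: "\<psi> 0 = 1"
    and psi_nontrivial: "\<psi> a \<noteq> 1"
begin

text \<open>If the form is nonzero on some vector of \<open>X\<close>, a multiple \<open>y\<close>
  of it has value \<open>a\<close>; translation by \<open>y\<close> preserves \<open>X\<close> and
  multiplies the sum by \<open>\<psi> a \<noteq> 1\<close>, so the sum is 0.\<close>

lemma sum_psi_dotp:
  assumes X: "fv.subspace X" and "finite X"
  shows "(\<Sum>x\<in>X. \<psi> (dotp n u x)) = (if \<forall>x\<in>X. dotp n u x = 0 then of_nat (card X) else 0)"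
proof (cases "\<forall>x\<in>X. dotp n u x = 0")
  case False
  then obtain x where x: "x \<in> X" "dotp n u x \<noteq> 0" by auto
  define y where "y = fscale (a / dotp n u x) x"
  have y: "y \<in> X" "dotp n u y = a"
    using x fv.subspace_scale[OF X] by (auto simp: y_def dotp_simps)
  let ?S = "\<Sum>x\<in>X. \<psi> (dotp n u x)"
  have "?S = (\<Sum>x\<in>X. \<psi> (dotp n u (x + y)))"
    by (rule sum.reindex_bij_witness[where i = "\<lambda>x. x + y" and j = "\<lambda>x. x - y"])
      (auto intro: fv.subspace_add[OF X] fv.subspace_diff[OF X] y(1))
  also have "\<dots> = ?S * \<psi> a" by (simp add: dotp_simps psi_add y(2) sum_distrib_right)
  finally have "?S = 0" using psi_nontrivial by simp
  then show ?thesis using False by (simp only: if_False)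
qed (simp add: psi_zero)

lemma sum_psi_coord_space:
  assumes u: "u \<in> coord_space n"
  shows "(\<Sum>x\<in>coord_space n. \<psi> (dotp n u x)) = (if u = 0 then of_nat (CARD('a) ^ n) else 0)"
proof -
  have "u = 0" if *: "\<forall>x\<in>coord_space n. dotp n u x = 0"
  proof (rule ccontr)
    assume "u \<noteq> 0"
    then obtain i where i: "i < n" "u i \<noteq> 0" using u coord_space_nonzero_coord by blast
    let ?e = "fscale 1 (\<lambda>j. if j = i then 1 else 0) :: nat \<Rightarrow> 'a"
    have "?e \<in> coord_space n" using i by (auto simp: coord_space_def fscale_def)
    then show False using * i dotp_unit[OF i(1), of u 1] by auto
  qed
  then have "(\<forall>x\<in>coord_space n. dotp n u x = 0) \<longleftrightarrow> u = 0" by (auto simp: dotp_zero_left)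
  then show ?thesis
    using sum_psi_dotp[OF subspace_coord_space finite_coord_space, of n u n] by (simp add: card_coord_space)
qed

text \<open>The full slice is the translate of \<open>coord_space n\<close> by the last unit vector,
  on which \<open>dotp n u\<close> vanishes.\<close>

lemma sum_psi_full_slice:
  assumes u: "u \<in> coord_space n"
  shows "(\<Sum>v\<in>slice n (coord_space (Suc n)). \<psi> (dotp n u v)) = (if u = 0 then of_nat (CARD('a) ^ n) else 0)"
proof -
  let ?e = "(\<lambda>j. if j = n then 1 else 0) :: nat \<Rightarrow> 'a"
  have e: "?e \<in> slice n (coord_space (Suc n))" by (auto simp: slice_def coord_space_def)
  have "dotp n u (?e + x) = dotp n u x" for x by (simp add: dotp_def)
  then have "(\<Sum>v\<in>slice n (coord_space (Suc n)). \<psi> (dotp n u v)) =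
      (\<Sum>x\<in>coord_space (Suc n) \<inter> coord_space n. \<psi> (dotp n u x))"
    using sum_slice[OF coord_space_in_Bq[OF order_refl] e, of "\<lambda>v. \<psi> (dotp n u v)"] by simp
  also have "coord_space (Suc n) \<inter> coord_space n = (coord_space n :: (nat \<Rightarrow> 'a) set)"
    using coord_space_mono[of n "Suc n"] by auto
  finally show ?thesis using sum_psi_coord_space[OF u] by simp
qed

text \<open>The Fourier coefficient at \<open>u\<close> of the indicator function of the slice,
  called \<open>G u Y\<close> in the opening text.\<close>

definition slice_sum :: "nat \<Rightarrow> (nat \<Rightarrow> 'a) \<Rightarrow> (nat \<Rightarrow> 'a) set \<Rightarrow> complex" where
  "slice_sum n u Y = (\<Sum>v\<in>slice n Y. \<psi> (dotp n u v))"

text \<open>\<open>h\<close> ranges over all functions without a support condition, since its values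
  away from subspaces of \<open>perp n u\<close> have no effect. A piece of the decomposition is
  then simply \<open>range (lift n u)\<close>.\<close>

definition lift :: "nat \<Rightarrow> (nat \<Rightarrow> 'a) \<Rightarrow> ((nat \<Rightarrow> 'a) set \<Rightarrow> complex) \<Rightarrow> (nat \<Rightarrow> 'a) set \<Rightarrow> complex" where
  "lift n u h Y = (if Y \<in> Bq (Suc n) then h (Y \<inter> coord_space n) * slice_sum n u Y else 0)"

text \<open>The slice is a coset of the intersection, so \<open>\<psi> (dotp n u v)\<close> splits
  off and leaves a character sum that \<open>sum_psi_dotp\<close> evaluates.\<close>

lemma slice_sum_eq:
  assumes Y: "Y \<in> Bq (Suc n)" and v: "v \<in> slice n Y"
  shows "slice_sum n u Y =
    (if Y \<inter> coord_space n \<subseteq> perp n u then of_nat (card (Y \<inter> coord_space n)) * \<psi> (dotp n u v) else 0)"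
proof -
  have X: "Y \<inter> coord_space n \<in> Bq n" using Bq_Int_coord_space[OF Y] .
  have "Y \<inter> coord_space n \<subseteq> perp n u \<longleftrightarrow> (\<forall>x\<in>Y \<inter> coord_space n. dotp n u x = 0)"
    by (auto simp: perp_def)
  moreover have "slice_sum n u Y = \<psi> (dotp n u v) * (\<Sum>x\<in>Y \<inter> coord_space n. \<psi> (dotp n u x))"
    unfolding slice_sum_def sum_slice[OF Y v] by (simp add: dotp_simps psi_add sum_distrib_left)
  ultimately show ?thesis
    unfolding sum_psi_dotp[OF BqD(1)[OF X] BqD(3)[OF X]] by simp
qed

lemma slice_sum_subset: "Y \<in> Bq (Suc n) \<Longrightarrow> Y \<subseteq> coord_space n \<Longrightarrow> slice_sum n u Y = 0"
  using slice_empty_iff[of Y n] by (simp add: slice_sum_def)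

text \<open>The dimension clause is the source of the shift of rank by one between \<open>h\<close>
  and its lift.\<close>

lemma slice_sum_nonzeroD:
  assumes "Y \<in> Bq (Suc n)" "slice_sum n u Y \<noteq> 0"
  shows "\<not> Y \<subseteq> coord_space n" "Y \<inter> coord_space n \<subseteq> perp n u"
    "fv.dim Y = fv.dim (Y \<inter> coord_space n) + 1"
proof -
  show *: "\<not> Y \<subseteq> coord_space n" using assms slice_sum_subset by blast
  then obtain v where v: "v \<in> slice n Y" using slice_empty_iff[OF assms(1)] by auto
  show "Y \<inter> coord_space n \<subseteq> perp n u"
    using slice_sum_eq[OF assms(1) v, of u] assms(2) by (auto split: if_splits)
  show "fv.dim Y = fv.dim (Y \<inter> coord_space n) + 1"
    using v dim_Int_coord_space[OF assms(1)] by (auto simp: slice_def)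
qed

lemma lift_cong:
  assumes "\<And>X. X \<in> Bq n \<Longrightarrow> X \<subseteq> perp n u \<Longrightarrow> h X = h' X"
  shows "lift n u h = lift n u h'"
proof
  fix Y show "lift n u h Y = lift n u h' Y"
    using assms[OF Bq_Int_coord_space, of Y] slice_sum_nonzeroD(2)[of Y n u]
    by (auto simp: lift_def)
qed

lemma lift_add: "lift n u (\<lambda>X. h X + h' X) = lift n u h + lift n u h'"
  by (auto simp: lift_def fun_eq_iff algebra_simps)

lemma lift_scale: "lift n u (\<lambda>X. c * h X) = fscale c (lift n u h)"
  by (auto simp: lift_def fun_eq_iff fscale_def)

lemma subspace_range_lift: "fv.subspace (range (lift n u))"
proof (rule fv.subspaceI)
  show "0 \<in> range (lift n u)" by (rule range_eqI[of _ _ "\<lambda>_. 0"]) (auto simp: lift_def fun_eq_iff)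
qed (auto simp: lift_add[symmetric] lift_scale[symmetric])

lemma lift_in_free_space: "lift n u h \<in> free_space (Bq (Suc n))"
  by (auto simp: free_space_def lift_def)

text \<open>With the slice sums expanded, \<open>sum_slices_covered\<close> turns the sum over the
  \<open>Z\<close> below \<open>Y\<close> into one over the \<open>X\<close> below
  \<open>Y \<inter> coord_space n\<close>, where the slice sum of \<open>Y\<close> is a common
  factor.\<close>

lemma up_op_lift: "up_op (Suc n) (lift n u h) = lift n u (up_op n h)"
proof
  fix Y
  show "up_op (Suc n) (lift n u h) Y = lift n u (up_op n h) Y"
  proof (cases "Y \<in> Bq (Suc n)")
    case True
    have "(\<Sum>Z\<in>covered_by (Suc n) Y. lift n u h Z) =
      (\<Sum>Z\<in>covered_by (Suc n) Y. \<Sum>v\<in>slice n Z. h (Z \<inter> coord_space n) * \<psi> (dotp n u v))"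
      by (rule sum.cong) (auto simp: lift_def slice_sum_def covered_by_def sum_distrib_left)
    also have "\<dots> = (\<Sum>X\<in>covered_by n (Y \<inter> coord_space n). \<Sum>v\<in>slice n Y. h X * \<psi> (dotp n u v))"
      by (rule sum_slices_covered[OF True])
    also have "\<dots> = (\<Sum>X\<in>covered_by n (Y \<inter> coord_space n). h X) * slice_sum n u Y"
      by (simp add: slice_sum_def sum_product)
    finally show ?thesis
      using True Bq_Int_coord_space[OF True] by (simp add: up_op_apply lift_def)
  qed (simp add: up_op_apply lift_def)
qed

text \<open>Where a slice sum is nonzero, intersecting lowers the dimension by exactly one, so
  truncating a lift by rank amounts to truncating \<open>h\<close>. Hence the pieces are
  homogeneous.\<close>

lemma hom_component_lift:
  "hom_component (Suc n) k (lift n u h) = lift n u (\<lambda>X. if fv.dim X + 1 = k then h X else 0)"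
proof
  fix Y
  show "hom_component (Suc n) k (lift n u h) Y = lift n u (\<lambda>X. if fv.dim X + 1 = k then h X else 0) Y"
    using slice_sum_nonzeroD(3)[of Y n u]
    by (cases "slice_sum n u Y = 0") (auto simp: hom_component_def lift_def Bq_level_def)
qed

text \<open>The characters of \<open>u\<close> and \<open>u'\<close> combine to that of
  \<open>u - u'\<close>. After \<open>sum_slices\<close>, its sum over the full slice is a separate
  factor: \<open>CARD('a) ^ n\<close> for \<open>u = u'\<close> and 0 otherwise.\<close>

lemma std_inner_lift:
  assumes u: "u \<in> coord_space n" and u': "u' \<in> coord_space n"
  shows "std_inner (Bq (Suc n)) (lift n u h) (lift n u' h') =
    (if u = u' then \<Sum>X\<in>{X \<in> Bq n. X \<subseteq> perp n u}. h X * cnj (h' X) * of_nat (CARD('a) ^ n * card X) else 0)"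
proof -
  \<comment> \<open>Only the second slice sum is evaluated in closed form; \<open>c\<close> is its
    part that is independent of the slice vector.\<close>
  define c where "c X = (if X \<subseteq> perp n u' then of_nat (card X) else 0 :: complex)" for X
  have *: "slice_sum n u Y * cnj (slice_sum n u' Y) =
      (\<Sum>v\<in>slice n Y. \<psi> (dotp n (u - u') v)) * c (Y \<inter> coord_space n)" if Y: "Y \<in> Bq (Suc n)" for Y
  proof -
    have "\<psi> (dotp n u v) * cnj (slice_sum n u' Y) = \<psi> (dotp n (u - u') v) * c (Y \<inter> coord_space n)"
      if v: "v \<in> slice n Y" for v
      using slice_sum_eq[OF Y v, of u'] psi_add[of "dotp n u v" "- dotp n u' v"]
      by (simp add: c_def dotp_simps cnj_psi)
    then show ?thesis by (simp add: slice_sum_def[of n u] sum_distrib_right)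
  qed
  have "std_inner (Bq (Suc n)) (lift n u h) (lift n u' h') =
    (\<Sum>Y\<in>Bq (Suc n). h (Y \<inter> coord_space n) * cnj (h' (Y \<inter> coord_space n)) *
       (slice_sum n u Y * cnj (slice_sum n u' Y)))"
    unfolding std_inner_def by (rule sum.cong) (auto simp: lift_def)
  also have "\<dots> = (\<Sum>Y\<in>Bq (Suc n). \<Sum>v\<in>slice n Y. h (Y \<inter> coord_space n) * cnj (h' (Y \<inter> coord_space n)) *
       c (Y \<inter> coord_space n) * \<psi> (dotp n (u - u') v))"
    by (rule sum.cong) (auto simp: * sum_distrib_left sum_distrib_right mult_ac)
  also have "\<dots> = (\<Sum>X\<in>Bq n. \<Sum>v\<in>slice n (coord_space (Suc n)). h X * cnj (h' X) * c X * \<psi> (dotp n (u - u') v))"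
    by (rule sum_slices)
  also have "\<dots> = (\<Sum>X\<in>Bq n. h X * cnj (h' X) * c X * (\<Sum>v\<in>slice n (coord_space (Suc n)). \<psi> (dotp n (u - u') v)))"
    by (simp add: sum_distrib_left)
  also have "\<dots> = (\<Sum>X\<in>Bq n. h X * cnj (h' X) * c X * (if u = u' then of_nat (CARD('a) ^ n) else 0))"
    using sum_psi_full_slice[OF fv.subspace_diff[OF subspace_coord_space u u']] by simp
  also have "\<dots> = (if u = u' then \<Sum>X\<in>Bq n. if X \<subseteq> perp n u then h X * cnj (h' X) * of_nat (CARD('a) ^ n * card X) else 0 else 0)"
    by (auto simp: c_def intro!: sum.cong)
  also have "\<dots> = (if u = u' then \<Sum>X\<in>{X \<in> Bq n. X \<subseteq> perp n u}. h X * cnj (h' X) * of_nat (CARD('a) ^ n * card X) else 0)"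
    by (simp only: sum.inter_filter[OF finite_Bq])
  finally show ?thesis .
qed

text \<open>The dual orthogonality relation, summing over \<open>u\<close>. Only equal slice vectors
  survive, and by \<open>extend_unique\<close> a common slice vector and a common intersection force
  \<open>Y = Y'\<close>.\<close>

lemma sum_slice_sum:
  assumes Y: "Y \<in> Bq (Suc n)" and Y': "Y' \<in> Bq (Suc n)"
    and eq: "Y \<inter> coord_space n = Y' \<inter> coord_space n"
  shows "(\<Sum>u\<in>coord_space n. slice_sum n u Y * cnj (slice_sum n u Y')) =
    (if Y = Y' then of_nat (CARD('a) ^ n * card (slice n Y)) else 0)"
proof -
  have "(\<Sum>u\<in>coord_space n. slice_sum n u Y * cnj (slice_sum n u Y')) =
     (\<Sum>u\<in>coord_space n. \<Sum>v\<in>slice n Y. \<Sum>w\<in>slice n Y'. \<psi> (dotp n (v - w) u))"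
  proof (rule sum.cong[OF refl])
    fix u
    have "\<psi> (dotp n u v) * cnj (\<psi> (dotp n u w)) = \<psi> (dotp n (v - w) u)" for v w
      using psi_add[of "dotp n u v" "- dotp n u w"]
      by (simp add: cnj_psi dotp_simps dotp_commute[of n u])
    then show "slice_sum n u Y * cnj (slice_sum n u Y') =
      (\<Sum>v\<in>slice n Y. \<Sum>w\<in>slice n Y'. \<psi> (dotp n (v - w) u))"
      by (simp add: slice_sum_def sum_product)
  qed
  also have "\<dots> = (\<Sum>v\<in>slice n Y. \<Sum>w\<in>slice n Y'. \<Sum>u\<in>coord_space n. \<psi> (dotp n (v - w) u))"
    by (subst sum.swap, rule sum.cong[OF refl], rule sum.swap)
  also have "\<dots> = (\<Sum>v\<in>slice n Y. \<Sum>w\<in>slice n Y'. if v = w then of_nat (CARD('a) ^ n) else 0)"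
  proof (intro sum.cong refl)
    fix v w assume "v \<in> slice n Y" "w \<in> slice n Y'"
    then have "v - w \<in> coord_space (Suc n) \<inter> coord_space n"
      using slice_subset[OF Y] slice_subset[OF Y'] slice_diff[OF coord_space_in_Bq[OF order_refl]] by blast
    then show "(\<Sum>u\<in>coord_space n. \<psi> (dotp n (v - w) u)) = (if v = w then of_nat (CARD('a) ^ n) else 0)"
      using sum_psi_coord_space by simp
  qed
  also have "\<dots> = (\<Sum>v\<in>slice n Y. if v \<in> slice n Y' then of_nat (CARD('a) ^ n) else 0)"
    by (simp add: finite_slice[OF Y'])
  also have "\<dots> = (\<Sum>v\<in>slice n Y. if Y = Y' then of_nat (CARD('a) ^ n) else 0)"
  proof (rule sum.cong[OF refl])
    fix v assume v: "v \<in> slice n Y"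
    have "v \<in> slice n Y' \<longleftrightarrow> Y = Y'" using extend_unique[OF Y v] extend_unique[OF Y', of v] eq v by auto
    then show "(if v \<in> slice n Y' then of_nat (CARD('a) ^ n) else 0 :: complex) = (if Y = Y' then of_nat (CARD('a) ^ n) else 0)"
      by simp
  qed
  finally show ?thesis by (simp add: mult.commute)
qed

text \<open>Fourier inversion, performed separately on each family of subspaces with the same
  intersection with \<open>coord_space n\<close>; the part of \<open>f\<close> on
  \<open>Bq n\<close> goes into \<open>g\<close>.\<close>

lemma lift_decomposition:
  assumes f: "f \<in> free_space (Bq (Suc n))"
  obtains g h where "g \<in> free_space (Bq n)" "f = g + (\<Sum>u\<in>coord_space n. lift n u (h u))"
proof -
  define g where "g X = (if X \<in> Bq n then f X else 0)" for X
  \<comment> \<open>The normalising constant is the diagonal value in \<open>sum_slice_sum\<close>,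
    as a nonempty slice has as many elements as the intersection.\<close>
  define h where "h u X = (\<Sum>Y\<in>{Y \<in> Bq (Suc n). Y \<inter> coord_space n = X}.
    f Y * cnj (slice_sum n u Y) / of_nat (CARD('a) ^ n * card X))" for u X
  have "f Y = g Y + (\<Sum>u\<in>coord_space n. lift n u (h u)) Y" for Y
  proof (cases "Y \<in> Bq (Suc n)")
    case False
    then have "Y \<notin> Bq n" using Bq_mono[of n "Suc n"] by auto
    then show ?thesis using False f by (simp add: sum_fun_apply lift_def g_def free_space_def)
  next
    case Y: True
    show ?thesis
    proof (cases "Y \<subseteq> coord_space n")
      case True
      then have "Y \<in> Bq n" using BqD[OF Y] by (auto simp: Bq_def)
      then show ?thesis using Y slice_sum_subset[OF Y True] by (simp add: sum_fun_apply lift_def g_def)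
    next
      case False
      then obtain v where v: "v \<in> slice n Y" using slice_empty_iff[OF Y] by auto
      let ?X = "Y \<inter> coord_space n"
      let ?N = "of_nat (CARD('a) ^ n * card ?X) :: complex"
      let ?A = "{Z \<in> Bq (Suc n). Z \<inter> coord_space n = ?X}"
      have "(\<Sum>u\<in>coord_space n. lift n u (h u)) Y =
        (\<Sum>u\<in>coord_space n. \<Sum>Z\<in>?A. f Z / ?N * (slice_sum n u Y * cnj (slice_sum n u Z)))"
        using Y by (simp add: sum_fun_apply lift_def h_def sum_distrib_left mult_ac)
      also have "\<dots> = (\<Sum>Z\<in>?A. f Z / ?N * (\<Sum>u\<in>coord_space n. slice_sum n u Y * cnj (slice_sum n u Z)))"
        by (subst sum.swap) (simp add: sum_distrib_left)
      also have "\<dots> = (\<Sum>Z\<in>?A. f Z / ?N * (if Y = Z then ?N else 0))"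
      proof (rule sum.cong[OF refl])
        fix Z assume "Z \<in> ?A"
        then have Z: "Z \<in> Bq (Suc n)" "Y \<inter> coord_space n = Z \<inter> coord_space n" by simp_all
        show "f Z / ?N * (\<Sum>u\<in>coord_space n. slice_sum n u Y * cnj (slice_sum n u Z)) =
          f Z / ?N * (if Y = Z then ?N else 0)"
          by (simp only: sum_slice_sum[OF Y Z] card_slice[OF Y v])
      qed
      also have "\<dots> = (\<Sum>Z\<in>?A. if Y = Z then f Z / ?N * ?N else 0)"
      proof (rule sum.cong[OF refl])
        fix Z show "f Z / ?N * (if Y = Z then ?N else 0) = (if Y = Z then f Z / ?N * ?N else 0)"
          by simp
      qed
      also have "\<dots> = f Y / ?N * ?N"
      proof -
        have "finite ?A" "Y \<in> ?A" using Y by (simp_all add: finite_Bq)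
        then show ?thesis by (simp only: sum.delta' if_True)
      qed
      also have "\<dots> = f Y" using card_Bq_pos[OF Bq_Int_coord_space[OF Y]] by simp
      finally have "(\<Sum>u\<in>coord_space n. lift n u (h u)) Y = f Y" .
      moreover have "g Y = 0" using False BqD(2)[of Y n] by (auto simp: g_def)
      ultimately show ?thesis by simp
    qed
  qed
  then have "f = g + (\<Sum>u\<in>coord_space n. lift n u (h u))" by (auto simp: fun_eq_iff)
  moreover have "g \<in> free_space (Bq n)" by (auto simp: g_def free_space_def)
  ultimately show thesis using that by blast
qed

text \<open>The supports are disjoint: \<open>g\<close> lives on subspaces of
  \<open>coord_space n\<close>, whose slices are empty.\<close>

lemma std_inner_free_space_lift:
  assumes "g \<in> free_space (Bq n)"
  shows "std_inner (Bq (Suc n)) g (lift n u h) = 0" "std_inner (Bq (Suc n)) (lift n u h) g = 0"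
proof -
  have "g Y = 0 \<or> lift n u h Y = 0" if "Y \<in> Bq (Suc n)" for Y
    using assms slice_sum_subset[OF that] BqD(2)[of Y n] by (auto simp: free_space_def lift_def)
  then have "\<forall>Y\<in>Bq (Suc n). g Y * cnj (lift n u h Y) = 0 \<and> lift n u h Y * cnj (g Y) = 0"
    by fastforce
  then have "\<forall>Y\<in>Bq (Suc n). g Y * cnj (lift n u h Y) = 0" "\<forall>Y\<in>Bq (Suc n). lift n u h Y * cnj (g Y) = 0"
    by blast+
  then show "std_inner (Bq (Suc n)) g (lift n u h) = 0" "std_inner (Bq (Suc n)) (lift n u h) g = 0"
    unfolding std_inner_def by (simp_all only: sum.neutral)
qed

end

lemma additive_character_exists: "\<exists>(\<psi> :: 'a::{field,finite} \<Rightarrow> complex) a. additive_character \<psi> a"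
proof (rule finite_field_nontrivial_character[where 'a = 'a])
  fix \<psi> :: "'a \<Rightarrow> complex" and a
  assume "\<And>x y. \<psi> (x + y) = \<psi> x * \<psi> y" "\<And>x. cnj (\<psi> x) = \<psi> (- x)" "\<psi> 0 = 1" "\<psi> a \<noteq> 1"
  then have "additive_character \<psi> a" by unfold_locales
  then show ?thesis by blast
qed

section \<open>Transport along a chart of an orthogonal complement\<close>

lemma std_inner_self_eq_0:
  assumes "finite S" "f \<in> free_space S" "std_inner S f f = 0"
  shows "f = 0"
proof -
  have "std_inner S f f = of_real (\<Sum>x\<in>S. (cmod (f x))\<^sup>2)"
    unfolding std_inner_def of_real_sum complex_norm_square ..
  then have "(\<Sum>x\<in>S. (cmod (f x))\<^sup>2) = 0" using assms(3) of_real_eq_0_iff by metis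
  then have "\<forall>x\<in>S. f x = 0" using assms(1) by (subst (asm) sum_nonneg_eq_0_iff) auto
  then show ?thesis using assms(2) by (auto simp: free_space_def fun_eq_iff)
qed

text \<open>
  A linear chart \<open>d\<close> of the hyperplane (or whole space) orthogonal to \<open>u\<close> pulls functions on
  \<open>Bq m\<close> back to functions on the subspaces of that hyperplane, which \<open>lift\<close> sends into
  \<open>V(B\<^sub>q(n+1))\<close>. The weight \<open>s\<close>, a function of the
  cardinality of a subspace, is \<open>1\<close> for the maps \<open>\<gamma>\<close> and the reciprocal for \<open>\<theta>\<close>.
\<close>

locale perp_chart = additive_character \<psi> a
  for \<psi> :: "'a::{field,finite} \<Rightarrow> complex" and a :: 'a +
  fixes n m :: nat and u :: "nat \<Rightarrow> 'a" and d :: "(nat \<Rightarrow> 'a) \<Rightarrow> nat \<Rightarrow> 'a"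
    and s :: "nat \<Rightarrow> real" and c :: real
  assumes u: "u \<in> coord_space n"
    and d_add: "d (v + w) = d v + d w"
    and d_scale: "d (fscale k v) = fscale k (d v)"
    and d_bij: "bij_betw d (perp n u) (coord_space m)"
    and s_pos: "j > 0 \<Longrightarrow> s j > 0"
    and s_mult: "s j = c * s (CARD('a) * j)"
begin

definition chart_map :: "((nat \<Rightarrow> 'a) set \<Rightarrow> complex) \<Rightarrow> (nat \<Rightarrow> 'a) set \<Rightarrow> complex" where
  "chart_map v = lift n u (\<lambda>X. of_real (s (card X)) * v (d ` X))"

lemma d_inj: "inj_on d (perp n u)"
  using d_bij by (auto simp: bij_betw_def)

lemma d_zero: "d 0 = 0"
  using d_scale[of 0 0] by simp

lemma perp_subset: "perp n u \<subseteq> coord_space n"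
  by (auto simp: perp_def)

lemma card_image_d: "X \<subseteq> perp n u \<Longrightarrow> card (d ` X) = card X"
  by (rule card_image) (rule inj_on_subset[OF d_inj])

lemma image_d_in_Bq:
  assumes "X \<in> Bq n" "X \<subseteq> perp n u"
  shows "d ` X \<in> Bq m"
proof -
  have X: "fv.subspace X" using BqD(1)[OF assms(1)] .
  have "fv.subspace (d ` X)"
    by (rule fv.subspaceI)
      (use fv.subspace_0[OF X] fv.subspace_add[OF X] fv.subspace_scale[OF X] d_zero in
        \<open>auto simp: d_add[symmetric] d_scale[symmetric] image_iff intro: bexI[of _ 0]\<close>)
  moreover have "d ` X \<subseteq> coord_space m" using assms(2) d_bij by (auto simp: bij_betw_def)
  ultimately show ?thesis by (simp add: Bq_def)
qed

lemma dim_image_d: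
  assumes "X \<in> Bq n" "X \<subseteq> perp n u"
  shows "fv.dim (d ` X) = fv.dim X"
  using dim_eq_iff_card[OF image_d_in_Bq[OF assms]] card_image_d[OF assms(2)] card_Bq[OF assms(1)] by simp

definition pull :: "(nat \<Rightarrow> 'a) set \<Rightarrow> (nat \<Rightarrow> 'a) set" where
  "pull Z = {x \<in> perp n u. d x \<in> Z}"

lemma pull_in_Bq:
  assumes "Z \<in> Bq m"
  shows "pull Z \<in> Bq n"
proof -
  note Z = BqD(1)[OF assms] and P = subspace_perp[of n u]
  have "fv.subspace (pull Z)"
    by (rule fv.subspaceI)
      (auto simp: pull_def d_zero d_add d_scale fv.subspace_0[OF Z] fv.subspace_add[OF Z]
        fv.subspace_scale[OF Z] fv.subspace_0[OF P] fv.subspace_add[OF P] fv.subspace_scale[OF P])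
  then show ?thesis using perp_subset by (auto simp: Bq_def pull_def)
qed

lemma pull_subset: "pull Z \<subseteq> perp n u"
  by (auto simp: pull_def)

lemma pull_image_d: "X \<subseteq> perp n u \<Longrightarrow> pull (d ` X) = X"
  using d_inj by (auto simp: pull_def inj_on_def)

lemma image_d_pull: "Z \<in> Bq m \<Longrightarrow> d ` pull Z = Z"
  using BqD(2)[of Z m] d_bij by (auto simp: pull_def bij_betw_def)

lemma sum_image_d: "(\<Sum>X\<in>{X \<in> Bq n. X \<subseteq> perp n u}. f (d ` X)) = (\<Sum>Z\<in>Bq m. f Z)"
  by (rule sum.reindex_bij_witness[where j = "\<lambda>X. d ` X" and i = pull])
    (use pull_subset in \<open>auto simp: pull_image_d image_d_pull image_d_in_Bq pull_in_Bq\<close>)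

text \<open>Images under \<open>d\<close> and their inverse \<open>pull\<close> preserve inclusions
  and cardinalities, hence covers.\<close>

lemma sum_covered_by_image_d:
  assumes X: "X \<in> Bq n" "X \<subseteq> perp n u"
  shows "(\<Sum>X'\<in>covered_by n X. f (d ` X')) = (\<Sum>Z\<in>covered_by m (d ` X). f Z)"
proof (rule sum.reindex_bij_witness[where j = "\<lambda>X. d ` X" and i = pull], goal_cases)
  case (1 X')
  then show ?case using X by (intro pull_image_d) (auto simp: covered_by_def)
next
  case (2 X')
  then have X': "X' \<in> Bq n" "X' \<subset> X" "card X = CARD('a) * card X'" "X' \<subseteq> perp n u"
    using X by (auto simp: covered_by_def)
  have "d ` X' \<noteq> d ` X" using X' X pull_image_d by (metis psubset_eq)
  then show ?case
    using X' X card_image_d image_d_in_Bq by (auto simp: covered_by_def)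
next
  case (3 Z)
  then show ?case by (intro image_d_pull) (auto simp: covered_by_def)
next
  case (4 Z)
  then have Z: "Z \<in> Bq m" "Z \<subset> d ` X" "card (d ` X) = CARD('a) * card Z"
    by (auto simp: covered_by_def)
  have "pull Z \<subseteq> pull (d ` X)" using Z by (auto simp: pull_def)
  then have "pull Z \<subseteq> X" using pull_image_d[OF X(2)] by simp
  moreover have "pull Z \<noteq> X" using image_d_pull[OF Z(1)] Z(2) by auto
  moreover have "card (pull Z) = card Z"
    using card_image_d[OF pull_subset, of Z] image_d_pull[OF Z(1)] by simp
  ultimately show ?case
    using Z card_image_d[OF X(2)] pull_in_Bq[OF Z(1)] by (auto simp: covered_by_def)
qed auto

text \<open>Passing from \<open>X\<close> to a subspace it covers divides the cardinality by the
  field size, so \<open>s_mult\<close> replaces the weight there by \<open>c\<close> times that of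
  \<open>X\<close>. This is how the factor \<open>q\<close> before the up operator arises for
  \<open>\<theta>\<close>.\<close>

lemma up_op_chart_map: "chart_map (fscale (of_real c) (up_op m v)) = up_op (Suc n) (chart_map v)"
  unfolding chart_map_def up_op_lift
proof (rule lift_cong)
  fix X assume X: "X \<in> Bq n" "X \<subseteq> perp n u"
  have "up_op n (\<lambda>X. of_real (s (card X)) * v (d ` X)) X =
    (\<Sum>X'\<in>covered_by n X. of_real (c * s (card X)) * v (d ` X'))"
    using X by (auto simp: up_op_apply covered_by_def s_mult[symmetric] intro!: sum.cong)
  also have "\<dots> = of_real (c * s (card X)) * (\<Sum>Z\<in>covered_by m (d ` X). v Z)"
    by (simp add: sum_distrib_left[symmetric] sum_covered_by_image_d[OF X])
  finally show "of_real (s (card X)) * fscale (of_real c) (up_op m v) (d ` X) =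
    up_op n (\<lambda>X. of_real (s (card X)) * v (d ` X)) X"
    using image_d_in_Bq[OF X] by (simp add: up_op_apply fscale_def)
qed

lemma std_inner_chart_map:
  "std_inner (Bq (Suc n)) (chart_map w) (chart_map v) =
   (\<Sum>Z\<in>Bq m. of_real ((s (card Z))\<^sup>2 * real (CARD('a) ^ n * card Z)) * (w Z * cnj (v Z)))"
proof -
  let ?g = "\<lambda>Z. of_real ((s (card Z))\<^sup>2 * real (CARD('a) ^ n * card Z)) * (w Z * cnj (v Z))"
  have "std_inner (Bq (Suc n)) (chart_map w) (chart_map v) = (\<Sum>X\<in>{X \<in> Bq n. X \<subseteq> perp n u}. ?g (d ` X))"
    unfolding chart_map_def std_inner_lift[OF u u] if_P[OF refl]
    by (rule sum.cong) (auto simp: card_image_d power2_eq_square)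
  then show ?thesis using sum_image_d[of ?g] by simp
qed

text \<open>On rank \<open>k\<close> all cardinalities equal \<open>CARD('a) ^ k\<close>, so the
  weight becomes a scalar.\<close>

lemma std_inner_chart_map_level:
  assumes "w \<in> free_space (Bq_level m k)"
  shows "std_inner (Bq (Suc n)) (chart_map w) (chart_map v) =
    of_real ((s (CARD('a) ^ k))\<^sup>2) * of_nat CARD('a) ^ (n + k) * std_inner (Bq m) w v"
  unfolding std_inner_chart_map std_inner_def[of "Bq m"] sum_distrib_left
proof (rule sum.cong[OF refl])
  fix Z :: "(nat \<Rightarrow> 'a) set" assume Z: "Z \<in> Bq m"
  show "of_real ((s (card Z))\<^sup>2 * real (CARD('a) ^ n * card Z)) * (w Z * cnj (v Z)) =
    of_real ((s (CARD('a) ^ k))\<^sup>2) * of_nat CARD('a) ^ (n + k) * (w Z * cnj (v Z))"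
    using assms Z card_Bq[OF Z]
    by (cases "fv.dim Z = k") (auto simp: free_space_def Bq_level_def power_add)
qed

lemma linear_chart_map: "linear_on V chart_map"
  unfolding linear_on_def chart_map_def lift_add[symmetric] lift_scale[symmetric]
  by (auto simp: fscale_def algebra_simps)

lemma chart_map_eq_0:
  assumes "v \<in> free_space (Bq m)" "chart_map v = 0"
  shows "v = 0"
proof -
  \<comment> \<open>Absorbing the square root of the total weight, which is positive on
    \<open>Bq m\<close>, makes the norm of \<open>w\<close> equal to that of
    \<open>chart_map v\<close>, so definiteness applies.\<close>
  define w where "w Z = of_real (s (card Z) * sqrt (real (CARD('a) ^ n * card Z))) * v Z" for Z
  have "std_inner (Bq m) w w = std_inner (Bq (Suc n)) (chart_map v) (chart_map v)"
    unfolding std_inner_chart_map std_inner_def[of "Bq m"]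
  proof (rule sum.cong[OF refl])
    fix Z :: "(nat \<Rightarrow> 'a) set"
    have "of_real (sqrt (real (CARD('a) ^ n * card Z))) * of_real (sqrt (real (CARD('a) ^ n * card Z)))
      = (of_real (real (CARD('a) ^ n * card Z)) :: complex)"
      unfolding of_real_mult[symmetric] by simp
    then show "w Z * cnj (w Z) = of_real ((s (card Z))\<^sup>2 * real (CARD('a) ^ n * card Z)) * (v Z * cnj (v Z))"
      by (simp add: w_def power2_eq_square)
  qed
  also have "\<dots> = 0" by (simp add: assms(2) std_inner_def)
  finally have "w = 0"
    using assms(1) by (intro std_inner_self_eq_0[of "Bq m"]) (auto simp: finite_Bq w_def free_space_def)
  show "v = 0"
  proof
    fix Z
    have "w Z = 0" using \<open>w = 0\<close> by simp
    then show "v Z = 0 Z"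
      using assms(1) card_Bq_pos[of Z m] s_pos[of "card Z"]
      by (cases "Z \<in> Bq m") (auto simp: w_def free_space_def)
  qed
qed

lemma chart_map_bij: "bij_betw chart_map (free_space (Bq m)) (range (lift n u))"
  unfolding bij_betw_def
proof
  show "inj_on chart_map (free_space (Bq m))"
  proof (rule inj_onI)
    fix v w assume vw: "v \<in> free_space (Bq m)" "w \<in> free_space (Bq m)" "chart_map v = chart_map w"
    have w: "fscale (-1) w \<in> free_space (Bq m)" "v + fscale (-1) w \<in> free_space (Bq m)"
      using vw by (auto simp: free_space_def fscale_def)
    have "chart_map (v + fscale (-1) w) = chart_map v + fscale (-1) (chart_map w)"
      using linear_chart_map[of UNIV] unfolding linear_on_def by (metis UNIV_I)
    also have "\<dots> = 0" using vw by (auto simp: fscale_def fun_eq_iff)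
    finally have "v + fscale (-1) w = 0" using chart_map_eq_0 w by blast
    then show "v = w" by (auto simp: fscale_def fun_eq_iff)
  qed
  show "chart_map ` free_space (Bq m) = range (lift n u)"
  proof safe
    fix h :: "(nat \<Rightarrow> 'a) set \<Rightarrow> complex"
    \<comment> \<open>The preimage undoes the chart and the weight; by \<open>lift_cong\<close> it
      has to reproduce \<open>h\<close> only on subspaces of \<open>perp n u\<close>.\<close>
    define v where "v Z = (if Z \<in> Bq m then h (pull Z) / of_real (s (card Z)) else 0)" for Z
    have "lift n u h = chart_map v"
      unfolding chart_map_def
    proof (rule lift_cong)
      fix X assume X: "X \<in> Bq n" "X \<subseteq> perp n u"
      then show "h X = of_real (s (card X)) * v (d ` X)"
        using s_pos[OF card_Bq_pos[OF X(1)]]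
        by (simp add: v_def image_d_in_Bq pull_image_d card_image_d)
    qed
    moreover have "v \<in> free_space (Bq m)" by (auto simp: v_def free_space_def)
    ultimately show "lift n u h \<in> chart_map ` free_space (Bq m)" by blast
  qed (auto simp: chart_map_def)
qed

lemma pair_iso_chart_map:
  "pair_iso (free_space (Bq m)) (\<lambda>v. fscale (of_real c) (up_op m v)) (range (lift n u)) (up_op (Suc n)) chart_map"
  unfolding pair_iso_def using linear_chart_map chart_map_bij up_op_chart_map by blast

lemma homogeneous_chart_map:
  assumes "homogeneous m k v"
  shows "homogeneous (Suc n) (Suc k) (chart_map v)"
proof -
  have v: "v \<noteq> 0" "v \<in> free_space (Bq_level m k)" using assms by (auto simp: homogeneous_def)
  then have "v \<in> free_space (Bq m)" by (auto simp: free_space_def Bq_level_def)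
  then have "chart_map v \<noteq> 0" using chart_map_eq_0 v(1) by blast
  moreover have "Y \<in> Bq_level (Suc n) (Suc k)" if "chart_map v Y \<noteq> 0" for Y
  proof -
    have Y: "Y \<in> Bq (Suc n)" "slice_sum n u Y \<noteq> 0" "v (d ` (Y \<inter> coord_space n)) \<noteq> 0"
      using that by (auto simp: chart_map_def lift_def split: if_splits)
    have "fv.dim (d ` (Y \<inter> coord_space n)) = k"
      using Y(3) v(2) by (auto simp: free_space_def Bq_level_def)
    then show ?thesis
      using slice_sum_nonzeroD[OF Y(1,2)] dim_image_d[OF Bq_Int_coord_space[OF Y(1)]] Y(1)
      by (simp add: Bq_level_def)
  qed
  ultimately show ?thesis by (auto simp: homogeneous_def free_space_def)
qed

lemma rankset_range_lift: "rankset (Suc n) (range (lift n u)) = {1..Suc m}"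
proof safe
  fix k assume "k \<in> rankset (Suc n) (range (lift n u))"
  then obtain h where h: "homogeneous (Suc n) k (lift n u h)" by (auto simp: rankset_def)
  then obtain Y where Y: "lift n u h Y \<noteq> 0" "fv.dim Y = k"
    by (fastforce simp: homogeneous_def fun_eq_iff free_space_def Bq_level_def)
  then have Y': "Y \<in> Bq (Suc n)" "slice_sum n u Y \<noteq> 0" by (auto simp: lift_def split: if_splits)
  note X = slice_sum_nonzeroD(2,3)[OF Y'] Bq_Int_coord_space[OF Y'(1)]
  have "fv.dim (Y \<inter> coord_space n) \<le> m"
    using dim_Bq_le[OF image_d_in_Bq[OF X(3,1)]] dim_image_d[OF X(3,1)] by simp
  then show "k \<in> {1..Suc m}" using X(2) Y(2) by simp
next
  fix k assume "k \<in> {1..Suc m}"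
  then obtain j where j: "k = Suc j" "j \<le> m" by (cases k) auto
  \<comment> \<open>The standard flag supplies a subspace of each dimension
    \<open>j \<le> m\<close>; the image of its basis vector has rank
    \<open>k = Suc j\<close>.\<close>
  let ?v = "basis_vec (coord_space j :: (nat \<Rightarrow> 'a) set)"
  have "homogeneous m j ?v"
    using j(2) by (auto simp: homogeneous_def basis_vec_def free_space_def Bq_level_def
      coord_space_in_Bq dim_coord_space fun_eq_iff)
  then have "homogeneous (Suc n) k (chart_map ?v)" using homogeneous_chart_map j(1) by blast
  then show "k \<in> rankset (Suc n) (range (lift n u))" unfolding rankset_def chart_map_def by blast
qed

end

text \<open>Where \<open>u i \<noteq> 0\<close>, orthogonality to \<open>u\<close> determines
  coordinate \<open>i\<close> from the others, so dropping it is injective; equal cardinalities make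
  it bijective.\<close>

lemma perp_coordinate_chart:
  fixes u :: "nat \<Rightarrow> 'a::{field,finite}"
  assumes u: "u \<in> coord_space n" "u \<noteq> 0"
  obtains d :: "(nat \<Rightarrow> 'a) \<Rightarrow> nat \<Rightarrow> 'a"
  where "\<And>v w. d (v + w) = d v + d w" "\<And>k v. d (fscale k v) = fscale k (d v)"
    "bij_betw d (perp n u) (coord_space (n - 1))"
proof -
  obtain i where i: "i < n" "u i \<noteq> 0" using coord_space_nonzero_coord[OF u] .
  \<comment> \<open>The last coordinate moves into the freed place \<open>i\<close>. For
    \<open>i = n - 1\<close> the second update prevails and the last coordinate is just
    dropped.\<close>
  define d where "d v = v(i := v (n - 1), n - 1 := 0)" for v :: "nat \<Rightarrow> 'a"
  have add: "d (v + w) = d v + d w" and scale: "d (fscale k v) = fscale k (d v)" for v w k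
    by (auto simp: d_def fun_eq_iff fscale_def)
  let ?e = "(\<lambda>j. if j = i then 1 else 0) :: nat \<Rightarrow> 'a"
  have e: "?e \<in> coord_space n" using i by (auto simp: coord_space_def)
  have "card (coord_space n :: (nat \<Rightarrow> 'a) set) = CARD('a) * card (perp n u)"
  proof (rule card_hyperplane[where w = ?e])
    show "perp n u \<subseteq> coord_space n" by (auto simp: perp_def)
    show "?e \<notin> perp n u" using i dotp_unit[OF i(1), of u 1] by (simp add: perp_def fscale_def)
    show "\<exists>c. y - fscale c ?e \<in> perp n u" if "y \<in> coord_space n" for y
    proof (rule exI[of _ "dotp n u y / u i"])
      have "y - fscale (dotp n u y / u i) ?e \<in> coord_space n"
        by (intro fv.subspace_diff fv.subspace_scale subspace_coord_space that e)
      then show "y - fscale (dotp n u y / u i) ?e \<in> perp n u"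
        using i by (simp add: perp_def dotp_simps(2) dotp_unit)
    qed
  qed (use e subspace_perp subspace_coord_space in auto)
  moreover have "CARD('a) ^ n = CARD('a) * CARD('a) ^ (n - 1)" using i by (cases n) auto
  ultimately have card_perp: "card (perp n u) = CARD('a) ^ (n - 1)" by (simp add: card_coord_space)
  have inj: "inj_on d (perp n u)"
  proof (rule inj_onI)
    fix v w assume v: "v \<in> perp n u" and w: "w \<in> perp n u" and eq: "d v = d w"
    define z where "z = v - w"
    have z: "z \<in> perp n u" using fv.subspace_diff[OF subspace_perp v w] by (simp add: z_def)
    have dz: "d z j = 0" for j using add[of z w] eq by (simp add: z_def fun_eq_iff)
    have zj: "z j = 0" if "j \<noteq> i" for j
      using dz[of j] dz[of i] that by (cases "j = n - 1") (auto simp: d_def split: if_splits)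
    have "0 = dotp n u z" using z by (simp add: perp_def)
    also have "\<dots> = (\<Sum>j<n. if j = i then u i * z i else 0)"
      unfolding dotp_def by (rule sum.cong) (auto simp: zj)
    finally have "z i = 0" using i by simp
    then have "z = 0" using zj by (metis ext zero_fun_apply)
    then show "v = w" by (simp add: z_def)
  qed
  have "d ` perp n u \<subseteq> coord_space (n - 1)"
    using i by (auto simp: d_def perp_def coord_space_def)
  moreover have "card (coord_space (n - 1) :: (nat \<Rightarrow> 'a) set) \<le> card (d ` perp n u)"
    by (simp add: card_image[OF inj] card_perp card_coord_space)
  ultimately have "d ` perp n u = coord_space (n - 1)"
    by (intro card_seteq finite_coord_space)
  with inj have "bij_betw d (perp n u) (coord_space (n - 1))" by (simp add: bij_betw_def)
  then show thesis using that[of d] add scale by blast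
qed

section \<open>Orthogonal direct sums and the up operator in one more dimension\<close>

text \<open>Uniqueness follows from orthogonality: the differences of two families of components sum
  to 0, and pairing this sum with one difference leaves its own norm.\<close>

lemma orth_direct_sumI:
  assumes "finite S" "finite I"
    and sub: "\<And>i. i \<in> I \<Longrightarrow> fv.subspace (A i)" "\<And>i. i \<in> I \<Longrightarrow> A i \<subseteq> free_space S"
    and orth: "\<And>i j v w. i \<in> I \<Longrightarrow> j \<in> I \<Longrightarrow> i \<noteq> j \<Longrightarrow> v \<in> A i \<Longrightarrow> w \<in> A j \<Longrightarrow> std_inner S v w = 0"
    and dec: "\<And>v. v \<in> free_space S \<Longrightarrow> \<exists>f. (\<forall>i\<in>I. f i \<in> A i) \<and> v = (\<Sum>i\<in>I. f i)"
  shows "orth_direct_sum S (free_space S) I A"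
  unfolding orth_direct_sum_def
proof (intro conjI ballI)
  show "fv.subspace (free_space S)" by (auto simp: fv.subspace_def free_space_def fscale_def)
  fix v assume "v \<in> free_space S"
  then obtain f where f: "\<forall>i\<in>I. f i \<in> A i" "v = (\<Sum>i\<in>I. f i)" using dec by blast
  show "\<exists>!f. f \<in> Pi\<^sub>E I A \<and> v = (\<Sum>i\<in>I. f i)"
  proof (rule ex_ex1I)
    show "\<exists>f. f \<in> Pi\<^sub>E I A \<and> v = (\<Sum>i\<in>I. f i)"
      using f by (intro exI[of _ "restrict f I"]) auto
    fix f g assume fg: "f \<in> Pi\<^sub>E I A \<and> v = (\<Sum>i\<in>I. f i)" "g \<in> Pi\<^sub>E I A \<and> v = (\<Sum>i\<in>I. g i)"
    have "f i = g i" if i: "i \<in> I" for i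
    proof -
      define \<delta> where "\<delta> j = f j - g j" for j
      have \<delta>: "\<delta> j \<in> A j" if "j \<in> I" for j
        using fg that unfolding \<delta>_def by (intro fv.subspace_diff sub) auto
      have "(\<Sum>j\<in>I. \<delta> j) = 0" using fg by (simp add: \<delta>_def sum_subtractf)
      then have "0 = std_inner S (\<delta> i) (\<Sum>j\<in>I. \<delta> j)" by (simp add: std_inner_def)
      also have "\<dots> = (\<Sum>j\<in>I. std_inner S (\<delta> i) (\<delta> j))"
        unfolding std_inner_def sum_fun_apply cnj_sum sum_distrib_left by (rule sum.swap)
      also have "\<dots> = (\<Sum>j\<in>I. if j = i then std_inner S (\<delta> i) (\<delta> i) else 0)"
        using orth[OF i _ _ \<delta>[OF i] \<delta>] by (intro sum.cong) auto
      also have "\<dots> = std_inner S (\<delta> i) (\<delta> i)" using i \<open>finite I\<close> by simp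
      finally have "\<delta> i = 0"
        using std_inner_self_eq_0[OF \<open>finite S\<close>] \<delta>[OF i] sub(2)[OF i] by auto
      then show ?thesis by (simp add: \<delta>_def)
    qed
    then show "f = g" using fg by (intro PiE_ext) auto
  qed
qed (use sub orth in auto)

text \<open>A subspace of \<open>coord_space n\<close> covered by \<open>Y\<close> lies in
  \<open>Y \<inter> coord_space n\<close> and is at least as large, hence equal to it; all other
  terms vanish because \<open>v\<close> is supported on \<open>Bq n\<close>.\<close>

lemma sum_covered_by_eq:
  fixes v :: "(nat \<Rightarrow> 'a::{field,finite}) set \<Rightarrow> complex"
  assumes v: "v \<in> free_space (Bq n)" and Y: "Y \<in> Bq (Suc n)" "\<not> Y \<subseteq> coord_space n"
  shows "(\<Sum>X\<in>covered_by (Suc n) Y. v X) = v (Y \<inter> coord_space n)"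
proof -
  obtain w where w: "w \<in> Y" "w n = 1" using Bq_Suc_not_subset[OF Y] .
  note card = card_Int_coord_space[OF Y(1) w]
  have "(\<Sum>X\<in>covered_by (Suc n) Y. v X) = (\<Sum>X\<in>{Y \<inter> coord_space n}. v X)"
  proof (rule sum.mono_neutral_right)
    show "{Y \<inter> coord_space n} \<subseteq> covered_by (Suc n) Y"
      using card Y Bq_Int_coord_space[OF Y(1)] Bq_mono[of n "Suc n"] by (auto simp: covered_by_def)
    show "\<forall>X\<in>covered_by (Suc n) Y - {Y \<inter> coord_space n}. v X = 0"
    proof (rule ballI, rule ccontr)
      fix X assume X: "X \<in> covered_by (Suc n) Y - {Y \<inter> coord_space n}" and "v X \<noteq> 0"
      then have "X \<in> Bq n" using v by (auto simp: free_space_def)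
      then have "X \<subseteq> Y \<inter> coord_space n" using X BqD(2) by (auto simp: covered_by_def)
      moreover have "card (Y \<inter> coord_space n) \<le> card X" using X card by (auto simp: covered_by_def)
      ultimately have "X = Y \<inter> coord_space n"
        by (intro card_seteq BqD(3)[OF Bq_Int_coord_space[OF Y(1)]])
      then show False using X by simp
    qed
  qed (rule finite_covered_by)
  then show ?thesis by simp
qed

lemma covered_by_Suc: "Y \<in> Bq n \<Longrightarrow> covered_by (Suc n) Y = covered_by n Y"
  using Bq_mono[of n "Suc n"] unfolding covered_by_def Bq_def by auto

context additive_character
begin

text \<open>Inside \<open>coord_space n\<close> nothing changes, giving \<open>up_op n v\<close>;
  any other \<open>Y\<close> receives the single value \<open>v (Y \<inter> coord_space n)\<close>.
  For \<open>u = 0\<close> the slice sum is the cardinality of the intersection, so dividing by it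
  reproduces that value: this dictates the weight of \<open>\<theta>\<close>.\<close>

lemma up_op_Suc:
  assumes v: "v \<in> free_space (Bq n)"
  shows "up_op (Suc n) v = up_op n v + lift n 0 (\<lambda>X. v X / of_nat (card X))"
proof
  fix Y
  have "up_op (Suc n) v Y = up_op n v Y + lift n 0 (\<lambda>X. v X / of_nat (card X)) Y"
  proof (cases "Y \<in> Bq (Suc n)")
    case False
    then have "Y \<notin> Bq n" using Bq_mono[of n "Suc n"] by auto
    then show ?thesis using False by (simp add: up_op_apply lift_def)
  next
    case Y: True
    show ?thesis
    proof (cases "Y \<subseteq> coord_space n")
      case True
      then have "Y \<in> Bq n" using Y by (auto simp: Bq_def)
      then show ?thesis
        using Y slice_sum_subset[OF Y True] by (simp add: up_op_apply lift_def covered_by_Suc)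
    next
      case False
      then have "Y \<notin> Bq n" by (auto simp: Bq_def)
      obtain w where "w \<in> slice n Y" using slice_empty_iff[OF Y] False by auto
      from slice_sum_eq[OF Y this, of 0]
      have "slice_sum n 0 Y = of_nat (card (Y \<inter> coord_space n))"
        by (simp add: perp_zero dotp_zero_left psi_zero)
      then show ?thesis
        using Y \<open>Y \<notin> Bq n\<close> sum_covered_by_eq[OF v Y False] card_Bq_pos[OF Bq_Int_coord_space[OF Y]]
        by (simp add: up_op_apply lift_def)
    qed
  qed
  then show "up_op (Suc n) v Y = (up_op n v + lift n 0 (\<lambda>X. v X / of_nat (card X))) Y" by simp
qed

text \<open>\<open>e\<close> enumerates the vectors \<open>u\<close>; index 0 belongs to
  \<open>free_space (Bq n)\<close>, so the piece of \<open>e i\<close> has index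
  \<open>Suc i\<close>.\<close>

lemma orth_direct_sum_lift:
  assumes e: "bij_betw e {0..t} (coord_space n)"
  shows "orth_direct_sum (Bq (Suc n)) (free_space (Bq (Suc n))) {0..Suc t}
    (case_nat (free_space (Bq n)) (\<lambda>i. range (lift n (e i))))"
proof (rule orth_direct_sumI)
  let ?A = "case_nat (free_space (Bq n)) (\<lambda>i. range (lift n (e i)))"
  show "fv.subspace (?A i)" for i
    by (cases i) (auto simp: subspace_range_lift, auto simp: fv.subspace_def free_space_def fscale_def)
  show "?A i \<subseteq> free_space (Bq (Suc n))" for i
    using lift_in_free_space Bq_mono[of n "Suc n"] by (cases i) (auto simp: free_space_def lift_def)
  show "std_inner (Bq (Suc n)) v w = 0"
    if ij: "i \<in> {0..Suc t}" "j \<in> {0..Suc t}" "i \<noteq> j" and vw: "v \<in> ?A i" "w \<in> ?A j" for i j v w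
  proof (cases i)
    case 0
    then show ?thesis using ij vw by (cases j) (auto simp: std_inner_free_space_lift)
  next
    case i: (Suc i')
    show ?thesis
    proof (cases j)
      case 0
      then show ?thesis using i vw by (auto simp: std_inner_free_space_lift)
    next
      case (Suc j')
      then have "e i' \<noteq> e j'" "e i' \<in> coord_space n" "e j' \<in> coord_space n"
        using e ij i by (auto simp: bij_betw_def inj_on_def)
      then show ?thesis using i Suc vw by (auto simp: std_inner_lift)
    qed
  qed
  show "\<exists>f. (\<forall>i\<in>{0..Suc t}. f i \<in> ?A i) \<and> v = (\<Sum>i\<in>{0..Suc t}. f i)"
    if "v \<in> free_space (Bq (Suc n))" for v
  proof -
    obtain g h where g: "g \<in> free_space (Bq n)" and v: "v = g + (\<Sum>u\<in>coord_space n. lift n u (h u))"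
      using lift_decomposition[OF \<open>v \<in> _\<close>] .
    have "(\<Sum>u\<in>coord_space n. lift n u (h u)) = (\<Sum>i\<in>{0..t}. lift n (e i) (h (e i)))"
      using sum.reindex_bij_betw[OF e, of "\<lambda>u. lift n u (h u)"] by simp
    also have "\<dots> = (\<Sum>i\<in>{Suc 0..Suc t}. case_nat g (\<lambda>i. lift n (e i) (h (e i))) i)"
      by (simp only: sum.shift_bounds_cl_Suc_ivl nat.case)
    finally have "v = (\<Sum>i\<in>{0..Suc t}. case_nat g (\<lambda>i. lift n (e i) (h (e i))) i)"
      using v by (subst sum.atLeast_Suc_atMost) auto
    then show ?thesis
      using g by (intro exI[of _ "case_nat g (\<lambda>i. lift n (e i) (h (e i)))"]) (auto split: nat.splits)
  qed
qed (auto simp: finite_Bq)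

lemma homogeneous_subspace_lift: "homogeneous_subspace (Suc n) (range (lift n u))"
  using subspace_range_lift lift_in_free_space by (auto simp: homogeneous_subspace_def hom_component_lift)

lemma up_closed_lift: "up_closed (Suc n) (range (lift n u))"
  by (auto simp: up_closed_def up_op_lift)

end

section \<open>Assembly of the decomposition\<close>

lemma up_op_add: "up_op m (v + w) = up_op m v + up_op m w"
  by (auto simp: fun_eq_iff up_op_apply sum.distrib)

lemma up_op_in_free_space: "up_op m v \<in> free_space (Bq m)"
  by (auto simp: free_space_def up_op_apply)

text \<open>Lets index 0 stand for \<open>u = 0\<close>, whose piece is the copy of
  \<open>free_space (Bq n)\<close>.\<close>

lemma bij_betw_atLeastAtMost_fix_0:
  assumes "finite A" "x \<in> A" "card A = t + 1"
  obtains e :: "nat \<Rightarrow> 'b" where "bij_betw e {0..t} A" "e 0 = x"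
proof -
  have "card {1..t} = card (A - {x})" using assms by simp
  then obtain f where f: "bij_betw f {1..t} (A - {x})"
    using finite_same_card_bij[of "{1..t}" "A - {x}"] assms(1) by auto
  have "bij_betw (f(0 := x)) {1..t} (A - {x})" using f by (subst bij_betw_cong[where g = f]) auto
  then have "bij_betw (f(0 := x)) ({1..t} \<union> {0}) ((A - {x}) \<union> {x})"
    using notIn_Un_bij_betw[of 0 "{1..t}" "f(0 := x)" "A - {x}"] by auto
  moreover have "{1..t} \<union> {0} = {0..t}" "(A - {x}) \<union> {x} = A" using assms(2) by auto
  ultimately show thesis using that[of "f(0 := x)"] by simp
qed

theorem theorem1p1:
  fixes n q t :: nat
  assumes q: "q = CARD('a::{field,finite})"
    and t: "t = q ^ n - 1"
  shows "\<exists>W :: nat \<Rightarrow> ((nat \<Rightarrow> 'a) set \<Rightarrow> complex) set.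
    orth_direct_sum (Bq (n + 1)) (free_space (Bq (n + 1)))
      {0..t + 1} (case_nat (free_space (Bq n)) W) \<and>
    (\<forall>i\<in>{0..t}. homogeneous_subspace (n + 1) (W i) \<and> up_closed (n + 1) (W i)) \<and>
    rankset (n + 1) (W 0) = {1..n + 1} \<and>
    (\<forall>i\<in>{1..t}. rankset (n + 1) (W i) = {1..n}) \<and>
    up_closed (n + 1) {v + w | v w. v \<in> free_space (Bq n) \<and> w \<in> W 0} \<and>
    (\<exists>\<theta> :: ((nat \<Rightarrow> 'a) set \<Rightarrow> complex) \<Rightarrow> ((nat \<Rightarrow> 'a) set \<Rightarrow> complex).
      pair_iso (free_space (Bq n)) (\<lambda>v. fscale (of_nat q) (up_op n v)) (W 0) (up_op (n + 1)) \<theta> \<and>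
      (\<forall>k v. homogeneous n k v \<longrightarrow> homogeneous (n + 1) (k + 1) (\<theta> v)) \<and>
      (\<forall>v\<in>free_space (Bq n). up_op (n + 1) v = up_op n v + \<theta> v) \<and>
      (\<forall>k\<in>{0..n}. \<forall>w\<in>free_space (Bq_level n k). \<forall>v\<in>free_space (Bq_level n k).
        std_inner (Bq (n + 1)) (\<theta> w) (\<theta> v) = of_nat q ^ (n - k) * std_inner (Bq n) w v)) \<and>
    (\<forall>i\<in>{1..t}. \<exists>\<gamma> :: ((nat \<Rightarrow> 'a) set \<Rightarrow> complex) \<Rightarrow> ((nat \<Rightarrow> 'a) set \<Rightarrow> complex).
      pair_iso (free_space (Bq (n - 1))) (up_op (n - 1)) (W i) (up_op (n + 1)) \<gamma> \<and>
      (\<forall>k v. homogeneous (n - 1) k v \<longrightarrow> homogeneous (n + 1) (k + 1) (\<gamma> v)) \<and>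
      (\<forall>k\<in>{0..n - 1}. \<forall>w\<in>free_space (Bq_level (n - 1) k). \<forall>v\<in>free_space (Bq_level (n - 1) k).
        std_inner (Bq (n + 1)) (\<gamma> w) (\<gamma> v) = of_nat q ^ (n + k) * std_inner (Bq (n - 1)) w v))"
proof -
  obtain \<psi> :: "'a \<Rightarrow> complex" and a where "additive_character \<psi> a"
    using additive_character_exists by blast
  then interpret additive_character \<psi> a .
  have q1: "q > 1" using q card_field_gt_1[where 'a='a] by simp
  have "card (coord_space n :: (nat \<Rightarrow> 'a) set) = t + 1" using q1 t by (simp add: card_coord_space q)
  moreover have zero: "0 \<in> (coord_space n :: (nat \<Rightarrow> 'a) set)" by (simp add: coord_space_def)
  ultimately obtain e :: "nat \<Rightarrow> nat \<Rightarrow> 'a" where e: "bij_betw e {0..t} (coord_space n)" and e0: "e 0 = 0"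
    using bij_betw_atLeastAtMost_fix_0[OF finite_coord_space] by metis
  have e_mem: "e i \<in> coord_space n" if "i \<in> {0..t}" for i using e that by (auto simp: bij_betw_def)
  have e_nz: "e i \<noteq> 0" if "i \<in> {1..t}" for i
  proof
    assume "e i = 0"
    then have "e i = e 0" using e0 by simp
    then have "i = 0" using e that unfolding bij_betw_def inj_on_def by auto
    then show False using that by simp
  qed
  define W where "W i = range (lift n (e i))" for i
  \<comment> \<open>For \<open>u = 0\<close> the complement is all of \<open>coord_space n\<close>
    and the identity is a chart; the weight \<open>1 / real k\<close> satisfies
    \<open>s_mult\<close> with constant \<open>q\<close>.\<close>
  interpret T: perp_chart \<psi> a n n 0 id "\<lambda>k. 1 / real k" "real q"
    by unfold_locales (use zero q1 in \<open>auto simp: perp_zero q\<close>)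
  let ?\<theta> = T.chart_map
  have W0: "W 0 = range (lift n 0)" by (simp add: W_def e0)
  have \<theta>_eq: "?\<theta> v = lift n 0 (\<lambda>X. v X / of_nat (card X))" for v
    by (simp add: T.chart_map_def)
  have \<theta>_iso: "pair_iso (free_space (Bq n)) (\<lambda>v. fscale (of_nat q) (up_op n v)) (W 0) (up_op (n + 1)) ?\<theta>"
    using T.pair_iso_chart_map by (simp add: W0)
  have \<theta>_up: "up_op (n + 1) v = up_op n v + ?\<theta> v" if "v \<in> free_space (Bq n)" for v
    using up_op_Suc[OF that] by (simp add: \<theta>_eq)
  have \<theta>_inner: "std_inner (Bq (n + 1)) (?\<theta> w) (?\<theta> v) = of_nat q ^ (n - k) * std_inner (Bq n) w v"
    if "k \<in> {0..n}" "w \<in> free_space (Bq_level n k)" for k w v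
  proof -
    \<comment> \<open>The squared weight removes the factor \<open>q ^ (2 * k)\<close> from
      \<open>q ^ (n + k)\<close>.\<close>
    have "n + k = (n - k) + k * 2" using that(1) by simp
    then have "(complex_of_nat q) ^ (n + k) = of_nat q ^ (n - k) * (of_nat q ^ k)\<^sup>2"
      by (metis power_add power_mult)
    then have "of_real ((1 / real (q ^ k))\<^sup>2) * of_nat q ^ (n + k) = (of_nat q :: complex) ^ (n - k)"
      using q1 by (simp add: power_divide)
    then show ?thesis using T.std_inner_chart_map_level[OF that(2), of v] by (simp add: q)
  qed
  have \<gamma>: "rankset (n + 1) (W i) = {1..n} \<and>
      (\<exists>\<gamma> :: ((nat \<Rightarrow> 'a) set \<Rightarrow> complex) \<Rightarrow> ((nat \<Rightarrow> 'a) set \<Rightarrow> complex).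
      pair_iso (free_space (Bq (n - 1))) (up_op (n - 1)) (W i) (up_op (n + 1)) \<gamma> \<and>
      (\<forall>k v. homogeneous (n - 1) k v \<longrightarrow> homogeneous (n + 1) (k + 1) (\<gamma> v)) \<and>
      (\<forall>k\<in>{0..n - 1}. \<forall>w\<in>free_space (Bq_level (n - 1) k). \<forall>v\<in>free_space (Bq_level (n - 1) k).
        std_inner (Bq (n + 1)) (\<gamma> w) (\<gamma> v) = of_nat q ^ (n + k) * std_inner (Bq (n - 1)) w v))"
    if i: "i \<in> {1..t}" for i
  proof -
    have ei: "e i \<in> coord_space n" "e i \<noteq> 0" using e_mem e_nz i by auto
    \<comment> \<open>A nonzero vector forces \<open>n > 0\<close>, so \<open>n - 1\<close> is a
      true predecessor; for \<open>n = 0\<close> there is no such \<open>i\<close>, as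
      \<open>t = 0\<close>.\<close>
    obtain j where "j < n" using coord_space_nonzero_coord[OF ei] .
    then have n: "Suc (n - 1) = n" by simp
    show ?thesis
    proof (rule perp_coordinate_chart[OF ei])
      fix d :: "(nat \<Rightarrow> 'a) \<Rightarrow> nat \<Rightarrow> 'a"
      assume "\<And>v w. d (v + w) = d v + d w" "\<And>k v. d (fscale k v) = fscale k (d v)"
        "bij_betw d (perp n (e i)) (coord_space (n - 1))"
      \<comment> \<open>Weight and constant are 1, so the up operator is transported without a
        factor and inner products on rank \<open>k\<close> scale by
        \<open>q ^ (n + k)\<close>.\<close>
      then interpret G: perp_chart \<psi> a n "n - 1" "e i" d "\<lambda>_. 1" 1
        by unfold_locales (use ei in auto)
      have "pair_iso (free_space (Bq (n - 1))) (up_op (n - 1)) (W i) (up_op (n + 1)) G.chart_map"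
        using G.pair_iso_chart_map by (simp add: W_def)
      moreover have "rankset (n + 1) (W i) = {1..n}"
        using G.rankset_range_lift unfolding n by (simp add: W_def)
      ultimately show ?thesis
        using G.homogeneous_chart_map G.std_inner_chart_map_level
        by (intro conjI exI[of _ G.chart_map]) (auto simp: q)
    qed
  qed
  have closed: "up_closed (n + 1) {v + w | v w. v \<in> free_space (Bq n) \<and> w \<in> W 0}"
    unfolding up_closed_def
  proof safe
    fix v w :: "(nat \<Rightarrow> 'a) set \<Rightarrow> complex"
    assume v: "v \<in> free_space (Bq n)" and w: "w \<in> W 0"
    \<comment> \<open>By \<open>\<theta>_up\<close>, the part of \<open>up_op (n + 1) v\<close>
      outside \<open>free_space (Bq n)\<close> is \<open>?\<theta> v\<close>, which lies in
      \<open>W 0\<close>.\<close>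
    have "?\<theta> v + up_op (n + 1) w \<in> W 0"
      using w up_closed_lift[of n 0] unfolding W0 \<theta>_eq up_closed_def
      by (intro fv.subspace_add[OF subspace_range_lift]) auto
    moreover have "up_op (n + 1) (v + w) = up_op n v + (?\<theta> v + up_op (n + 1) w)"
      by (simp only: up_op_add \<theta>_up[OF v] add.assoc)
    ultimately show "\<exists>v' w'. up_op (n + 1) (v + w) = v' + w' \<and> v' \<in> free_space (Bq n) \<and> w' \<in> W 0"
      using up_op_in_free_space by blast
  qed
  show ?thesis
  proof (rule exI[of _ W], intro conjI)
    show "orth_direct_sum (Bq (n + 1)) (free_space (Bq (n + 1))) {0..t + 1} (case_nat (free_space (Bq n)) W)"
      using orth_direct_sum_lift[OF e] by (simp add: W_def[abs_def])
    show "\<forall>i\<in>{0..t}. homogeneous_subspace (n + 1) (W i) \<and> up_closed (n + 1) (W i)"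
      by (simp add: W_def homogeneous_subspace_lift up_closed_lift)
    show "rankset (n + 1) (W 0) = {1..n + 1}" using T.rankset_range_lift by (simp add: W0)
    show "\<forall>i\<in>{1..t}. rankset (n + 1) (W i) = {1..n}" using \<gamma> by blast
    show "up_closed (n + 1) {v + w | v w. v \<in> free_space (Bq n) \<and> w \<in> W 0}" by (rule closed)
    show "\<exists>\<theta> :: ((nat \<Rightarrow> 'a) set \<Rightarrow> complex) \<Rightarrow> ((nat \<Rightarrow> 'a) set \<Rightarrow> complex).
      pair_iso (free_space (Bq n)) (\<lambda>v. fscale (of_nat q) (up_op n v)) (W 0) (up_op (n + 1)) \<theta> \<and>
      (\<forall>k v. homogeneous n k v \<longrightarrow> homogeneous (n + 1) (k + 1) (\<theta> v)) \<and>
      (\<forall>v\<in>free_space (Bq n). up_op (n + 1) v = up_op n v + \<theta> v) \<and>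
      (\<forall>k\<in>{0..n}. \<forall>w\<in>free_space (Bq_level n k). \<forall>v\<in>free_space (Bq_level n k).
        std_inner (Bq (n + 1)) (\<theta> w) (\<theta> v) = of_nat q ^ (n - k) * std_inner (Bq n) w v)"
      using \<theta>_iso T.homogeneous_chart_map \<theta>_up \<theta>_inner by (intro exI[of _ ?\<theta>] conjI) auto
  qed (use \<gamma> in blast)
qed

end
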